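(* Let $k\in\mathbb{N}$ be fixed, let $\mathcal{G}$ be the class of all graphs all of whose connected components have at most $k$ vertices, and let $G_n$ be chosen uniformly at random from the graphs in $\mathcal{G}$ with vertex set $\{1,\dots,n\}$. Then $G_n$ obeys the MSO zero-one law: for every MSO sentence $\varphi$, $\lim_{n\to\infty}\Pr(G_n\models\varphi)$ exists and is $0$ or $1$.
   Context: MSO is monadic second-order logic of graphs: first-order logic (vertex variables, $=$, adjacency) enriched with quantification over sets of vertices and membership $x\in X$. *)

theory Defs
  imports "HOL-Probability.Probability" "Graph_Theory.Graph_Theory"
begin

section \<open>Monadic second-order logic of graphs\<close>

text \<open>
  Vertex variables and set variables are two separate copies of the natural numbers.
  The remaining connectives, universal quantifiers and equality of sets are definable.
\<close>

datatype mso =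
    Eq nat nat
  | Adj nat nat
  | Mem nat nat  \<comment> \<open>vertex variable first, set variable second\<close>
  | Neg mso
  | Conj mso mso
  | ExV nat mso
  | ExS nat mso

primrec free_vertex_vars :: "mso \<Rightarrow> nat set" where
  "free_vertex_vars (Eq x y) = {x, y}"
| "free_vertex_vars (Adj x y) = {x, y}"
| "free_vertex_vars (Mem x X) = {x}"
| "free_vertex_vars (Neg \<phi>) = free_vertex_vars \<phi>"
| "free_vertex_vars (Conj \<phi> \<psi>) = free_vertex_vars \<phi> \<union> free_vertex_vars \<psi>"
| "free_vertex_vars (ExV x \<phi>) = free_vertex_vars \<phi> - {x}"
| "free_vertex_vars (ExS X \<phi>) = free_vertex_vars \<phi>"

primrec free_set_vars :: "mso \<Rightarrow> nat set" where
  "free_set_vars (Eq x y) = {}"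
| "free_set_vars (Adj x y) = {}"
| "free_set_vars (Mem x X) = {X}"
| "free_set_vars (Neg \<phi>) = free_set_vars \<phi>"
| "free_set_vars (Conj \<phi> \<psi>) = free_set_vars \<phi> \<union> free_set_vars \<psi>"
| "free_set_vars (ExV x \<phi>) = free_set_vars \<phi>"
| "free_set_vars (ExS X \<phi>) = free_set_vars \<phi> - {X}"

definition mso_sentence :: "mso \<Rightarrow> bool" where
  "mso_sentence \<phi> \<longleftrightarrow> free_vertex_vars \<phi> = {} \<and> free_set_vars \<phi> = {}"

primrec mso_sat ::
  "'a pair_pre_digraph \<Rightarrow> (nat \<Rightarrow> 'a) \<Rightarrow> (nat \<Rightarrow> 'a set) \<Rightarrow> mso \<Rightarrow> bool" where
  "mso_sat G v V (Eq x y) \<longleftrightarrow> v x = v y"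
| "mso_sat G v V (Adj x y) \<longleftrightarrow> (v x, v y) \<in> parcs G"
| "mso_sat G v V (Mem x X) \<longleftrightarrow> v x \<in> V X"
| "mso_sat G v V (Neg \<phi>) \<longleftrightarrow> \<not> mso_sat G v V \<phi>"
| "mso_sat G v V (Conj \<phi> \<psi>) \<longleftrightarrow> mso_sat G v V \<phi> \<and> mso_sat G v V \<psi>"
| "mso_sat G v V (ExV x \<phi>) \<longleftrightarrow> (\<exists>a\<in>pverts G. mso_sat G (v(x := a)) V \<phi>)"
| "mso_sat G v V (ExS X \<phi>) \<longleftrightarrow> (\<exists>A\<subseteq>pverts G. mso_sat G v (V(X := A)) \<phi>)"

lemma mso_sat_cong:
  assumes "\<And>x. x \<in> free_vertex_vars \<phi> \<Longrightarrow> v x = v' x"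
    and "\<And>X. X \<in> free_set_vars \<phi> \<Longrightarrow> V X = V' X"
  shows "mso_sat G v V \<phi> \<longleftrightarrow> mso_sat G v' V' \<phi>"
  using assms
proof (induction \<phi> arbitrary: v v' V V')
  case (Conj \<phi> \<psi>)
  have "mso_sat G v V \<phi> \<longleftrightarrow> mso_sat G v' V' \<phi>"
    using Conj.prems by (intro Conj.IH(1)) simp_all
  moreover have "mso_sat G v V \<psi> \<longleftrightarrow> mso_sat G v' V' \<psi>"
    using Conj.prems by (intro Conj.IH(2)) simp_all
  ultimately show ?case by simp
next
  case (Neg \<phi>)
  have "mso_sat G v V \<phi> \<longleftrightarrow> mso_sat G v' V' \<phi>"
    using Neg.prems by (intro Neg.IH) simp_all
  then show ?case by simp
next
  case (ExV x \<phi>)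
  have "mso_sat G (v(x := a)) V \<phi> \<longleftrightarrow> mso_sat G (v'(x := a)) V' \<phi>" for a
    using ExV.prems by (intro ExV.IH) auto
  then show ?case by simp
next
  case (ExS X \<phi>)
  have "mso_sat G v (V(X := A)) \<phi> \<longleftrightarrow> mso_sat G v' (V'(X := A)) \<phi>" for A
    using ExS.prems by (intro ExS.IH) auto
  then show ?case by simp
qed simp_all

text \<open>
  The assignments need not take values in the graph; for a sentence they are irrelevant,
  see \<open>mso_models_iff_sat\<close>.
\<close>

definition mso_models :: "'a pair_pre_digraph \<Rightarrow> mso \<Rightarrow> bool" where
  "mso_models G \<phi> \<longleftrightarrow> (\<forall>v V. mso_sat G v V \<phi>)"

lemma mso_models_iff_sat:
  assumes "mso_sentence \<phi>"
  shows "mso_models G \<phi> \<longleftrightarrow> mso_sat G v V \<phi>"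
proof -
  have "mso_sat G v' V' \<phi> \<longleftrightarrow> mso_sat G v V \<phi>" for v' V'
    using assms by (intro mso_sat_cong) (simp_all add: mso_sentence_def)
  then show ?thesis unfolding mso_models_def by blast
qed

section \<open>Graphs with bounded components\<close>

text \<open>
  A \<^locale>\<open>pair_graph\<close> is a finite simple graph, an edge \<open>uv\<close> being represented by the two arcs
  \<open>(u, v)\<close> and \<open>(v, u)\<close>. Its connected components are its maximal connected subgraphs. The name
  \<open>connected\<close> has to be qualified because it also denotes topological connectedness.
\<close>

definition is_component :: "('a, 'a \<times> 'a) pre_digraph \<Rightarrow> 'a pair_pre_digraph \<Rightarrow> bool" where
  "is_component H G \<longleftrightarrow>
     pre_digraph.max_subgraph (with_proj G) Digraph_Component.connected H"

definition bounded_component_graphs :: "nat \<Rightarrow> 'a pair_pre_digraph set" where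
  "bounded_component_graphs k =
     {G. pair_graph G \<and> (\<forall>H. is_component H G \<longrightarrow> card (verts H) \<le> k)}"

definition bounded_component_graphs_on :: "nat \<Rightarrow> nat \<Rightarrow> nat pair_pre_digraph set" where
  "bounded_component_graphs_on k n = {G \<in> bounded_component_graphs k. pverts G = {1..n}}"

text \<open>
  For \<open>k \<ge> 1\<close> the set is finite and contains the edgeless graph, so that the uniform
  distribution on it makes sense. For \<open>k = 0\<close> and \<open>n \<ge> 1\<close> it is empty.
\<close>

lemma finite_bounded_component_graphs_on: "finite (bounded_component_graphs_on k n)"
proof (rule finite_subset)
  show "bounded_component_graphs_on k n \<subseteq>
    (\<lambda>E. \<lparr>pverts = {1..n}, parcs = E\<rparr>) ` Pow ({1..n} \<times> {1..n})"
  proof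
    fix G assume "G \<in> bounded_component_graphs_on k n"
    then have G: "pair_graph G" "pverts G = {1..n}"
      by (auto simp: bounded_component_graphs_on_def bounded_component_graphs_def)
    interpret pair_graph G by (rule G)
    have "parcs G \<subseteq> {1..n} \<times> {1..n}"
      unfolding G(2)[symmetric] by (auto dest: in_arcsD1 in_arcsD2)
    moreover have "G = \<lparr>pverts = {1..n}, parcs = parcs G\<rparr>"
      unfolding G(2)[symmetric] by simp
    ultimately show "G \<in> (\<lambda>E. \<lparr>pverts = {1..n}, parcs = E\<rparr>) ` Pow ({1..n} \<times> {1..n})"
      by (intro image_eqI[where x = "parcs G"] PowI)
  qed
qed simp

lemma edgeless_in_bounded_component_graphs_on:
  assumes "k \<ge> 1"
  shows "\<lparr>pverts = {1..n}, parcs = {}\<rparr> \<in> bounded_component_graphs_on k n"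
proof -
  let ?G = "\<lparr>pverts = {1..n}, parcs = {}\<rparr> :: nat pair_pre_digraph"
  have "pair_graph ?G"
    by unfold_locales (auto simp: symmetric_def sym_def)
  moreover have "card (verts H) \<le> k" if H: "is_component H ?G" for H
  proof -
    have sub: "subgraph H (with_proj ?G)" and con: "Digraph_Component.connected H"
      using H by (auto simp: is_component_def pre_digraph.max_subgraph_def)
    have "arcs H = {}" using sub by (auto simp: subgraph_def)
    then have "parcs (mk_symmetric H) = {}" by (simp add: mk_symmetric_def)
    have "u = w" if uw: "u \<in> verts H" "w \<in> verts H" for u w
    proof -
      have "u \<rightarrow>\<^sup>*\<^bsub>with_proj (mk_symmetric H)\<^esub> w"
        using con uw by (simp add: connected_def strongly_connected_def mk_symmetric_def)
      then show ?thesis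
        using \<open>parcs (mk_symmetric H) = {}\<close>
        by (auto simp: reachable_def elim: rtrancl_on.cases)
    qed
    then have "card (verts H) \<le> 1"
      by (cases "finite (verts H)") (simp_all add: card_le_Suc0_iff_eq)
    then show ?thesis using assms by simp
  qed
  ultimately show ?thesis
    by (simp add: bounded_component_graphs_on_def bounded_component_graphs_def)
qed

definition random_graph :: "nat \<Rightarrow> nat \<Rightarrow> nat pair_pre_digraph pmf" where
  "random_graph k n = pmf_of_set (bounded_component_graphs_on k n)"

end

theory Submission
  imports Defs
begin

text \<open>
  A graph with components of bounded size is a disjoint union of copies of finitely many patterns.
  Colour each component by its pattern together with the traces of the current variable assignment.
  In an Ehrenfeucht-Fraisse game only the multiplicities of the colours matter, and these only up
  to a threshold depending on the formula. So it suffices that every pattern occurs more often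
  than any fixed bound with probability tending to \<open>1\<close>, and this follows from two switchings.
  Deleting the arcs of one of the at least \<open>n / k\<close> components shows that few isolated vertices are
  unlikely. Planting a pattern with \<open>h\<close> vertices on \<open>h\<close> of the many isolated vertices can be
  undone in only a few ways if the result has few copies of it, so few copies are unlikely as well.
\<close>

section \<open>Multiplicities up to a threshold\<close>

text \<open>The measure is uniform, so a switching is an injection from pairs (graph, choice) into
  pairs (graph, record). Each probability estimate is then a quotient of two crude counts, and no
  asymptotic enumeration of the class enters. Isolated vertices have to come before patterns because
  a planted pattern can be erased without knowing the former graph only where there were no arcs.
  Their number \<open>r\<close> is fixed before \<open>n\<close> grows: the second quotient, (m + 1)
  / (r choose h), is made small by \<open>r\<close> alone. The obstacle in the game is that an
  answer must be an actual set or vertex of the other graph, not merely a labelling of its blocks;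
  the colours therefore record the block sizes. A component matches several patterns under different
  numberings, so one representative is selected for each isomorphism class to make the colour of a
  component well defined. Two graphs with many copies of every representative agree on the sentence
  even if their sizes differ, so its truth value on such graphs does not depend on \<open>n\<close>.
  This gives both the existence of the limit and its value.\<close>

lemma min_add_split:
  fixes a b p q y :: nat
  assumes "min (a + b) (p + q) = min (a + b) y"
  obtains p' q' where "y = p' + q'" "min a p = min a p'" "min b q = min b q'"
proof -
  \<comment> \<open>Unless the totals agree, both reach the cap a + b. A summand below its own cap
    is then kept unchanged, and the other one is above its cap on both sides.\<close>
  consider "y = p + q" | "p + q \<ge> a + b" "y \<ge> a + b" "p < a"
    | "p + q \<ge> a + b" "y \<ge> a + b" "q < b" | "y \<ge> a + b" "p \<ge> a" "q \<ge> b"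
    using assms by linarith
  then show thesis
  proof cases
    case 1 then show ?thesis by (rule that) auto
  next
    case 2 then show ?thesis by (intro that[of p "y - p"]) auto
  next
    case 3 then show ?thesis by (intro that[of "y - q" q]) auto
  next
    case 4 then show ?thesis by (intro that[of a "y - a"]) auto
  qed
qed

text \<open>The colours are peeled off one at a time. Each spends \<open>T\<close> of the cap
  \<open>card C * T\<close>, and \<open>min_add_split\<close> says how many elements of
  \<open>Y\<close> receive the peeled colour.\<close>

lemma colouring_transfer:
  fixes T :: nat
  assumes "finite C" "C \<noteq> {}" "finite X" "finite Y" "A ` X \<subseteq> C"
    and "min (card C * T) (card X) = min (card C * T) (card Y)"
  shows "\<exists>B. B ` Y \<subseteq> C \<and>
    (\<forall>c\<in>C. min T (card {x\<in>X. A x = c}) = min T (card {y\<in>Y. B y = c}))"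
  using assms
proof (induction C arbitrary: X Y rule: finite_ne_induct)
  case (singleton c)
  then have "{x\<in>X. A x = c} = X" by auto
  with singleton show ?case by (intro exI[of _ "\<lambda>_. c"]) auto
next
  case (insert c C)
  let ?P = "{x\<in>X. A x = c}" and ?Q = "{x\<in>X. A x \<noteq> c}"
  have "card X = card ?P + card ?Q"
    using insert.prems by (subst card_Un_disjoint[symmetric]) (auto intro!: arg_cong[where f = card])
  with insert have "min (T + card C * T) (card ?P + card ?Q) = min (T + card C * T) (card Y)"
    by simp
  then obtain p q where pq: "card Y = p + q" "min T (card ?P) = min T p"
    "min (card C * T) (card ?Q) = min (card C * T) q"
    by (rule min_add_split)
  obtain Z where Z: "Z \<subseteq> Y" "card Z = p"
    using pq(1) by (metis le_add1 obtain_subset_with_card_n)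
  have "card (Y - Z) = q"
    using Z pq insert.prems by (simp add: card_Diff_subset finite_subset)
  moreover have "A ` ?Q \<subseteq> C" using insert.prems by auto
  ultimately obtain B where B: "B ` (Y - Z) \<subseteq> C"
    "\<forall>d\<in>C. min T (card {x\<in>?Q. A x = d}) = min T (card {y\<in>Y - Z. B y = d})"
    using insert.IH[of ?Q "Y - Z"] insert.prems pq(3) by auto
  let ?B = "\<lambda>y. if y \<in> Z then c else B y"
  have "min T (card {x\<in>X. A x = d}) = min T (card {y\<in>Y. ?B y = d})" if "d \<in> insert c C" for d
  proof (cases "d = c")
    case True
    have "{y\<in>Y. ?B y = c} = Z" using Z B(1) insert.hyps by auto
    then show ?thesis using True pq Z by simp
  next
    case False
    have "{y\<in>Y. ?B y = d} = {y\<in>Y - Z. B y = d}" "{x\<in>X. A x = d} = {x\<in>?Q. A x = d}"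
      using False by auto
    then show ?thesis using B(2) False that by auto
  qed
  moreover have "?B ` Y \<subseteq> insert c C" using B(1) by auto
  ultimately show ?case by (intro exI[of _ ?B]) blast
qed

text \<open>The invariant of the game: the multisets of colours coincide once multiplicities are
  truncated at \<open>T\<close>.\<close>

definition counts_agree ::
  "nat \<Rightarrow> 'i set \<Rightarrow> ('i \<Rightarrow> 'c) \<Rightarrow> 'j set \<Rightarrow> ('j \<Rightarrow> 'c) \<Rightarrow> bool" where
  "counts_agree T I F J F' \<longleftrightarrow>
     (\<forall>c. min T (card {i\<in>I. F i = c}) = min T (card {j\<in>J. F' j = c}))"

lemma counts_agree_mono:
  assumes "counts_agree T I F J F'" "S \<le> T"
  shows "counts_agree S I F J F'"
  unfolding counts_agree_def
proof
  fix c
  have "min T (card {i\<in>I. F i = c}) = min T (card {j\<in>J. F' j = c})"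
    using assms(1) by (simp add: counts_agree_def)
  then show "min S (card {i\<in>I. F i = c}) = min S (card {j\<in>J. F' j = c})"
    using assms(2) by linarith
qed

lemma counts_agree_sym: "counts_agree T I F J F' \<Longrightarrow> counts_agree T J F' I F"
  by (simp add: counts_agree_def)

lemma min_sum_cong:
  fixes f g :: "'a \<Rightarrow> nat"
  assumes "finite A" "\<And>x. x \<in> A \<Longrightarrow> min T (f x) = min T (g x)"
  shows "min T (sum f A) = min T (sum g A)"
  using assms
proof (induction A rule: finite_induct)
  case (insert x A)
  have "min T (f x) = min T (g x)" "min T (sum f A) = min T (sum g A)" using insert by auto
  then show ?case unfolding sum.insert[OF insert.hyps] by linarith
qed simp

text \<open>Truncation at \<open>T\<close> is compatible with addition, so agreement passes from
  single colours to unions of colour classes.\<close>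

lemma counts_agree_pred:
  assumes "counts_agree T I F J F'" "finite I" "finite J"
  shows "min T (card {i\<in>I. P (F i)}) = min T (card {j\<in>J. P (F' j)})"
proof -
  \<comment> \<open>Only colours that occur on one of the two sides enter, since the colour type may
    be infinite; both sums run over the same finite set.\<close>
  let ?S = "{c \<in> F ` I \<union> F' ` J. P c}"
  have *: "card {i\<in>K. P (H i)} = (\<Sum>c\<in>?S. card {i\<in>K. H i = c})"
    if "finite K" "H ` K \<subseteq> F ` I \<union> F' ` J" for K and H :: "'d \<Rightarrow> 'b"
  proof -
    have "{i\<in>K. P (H i)} = (\<Union>c\<in>?S. {i\<in>K. H i = c})" using that by auto
    also have "card \<dots> = (\<Sum>c\<in>?S. card {i\<in>K. H i = c})"
      using that assms by (intro card_UN_disjoint) auto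
    finally show ?thesis .
  qed
  have "min T (\<Sum>c\<in>?S. card {i\<in>I. F i = c}) = min T (\<Sum>c\<in>?S. card {j\<in>J. F' j = c})"
    using assms by (intro min_sum_cong) (auto simp: counts_agree_def)
  then show ?thesis using *[of I F] *[of J F'] assms(2,3) by simp
qed

lemma counts_agree_comp:
  assumes "counts_agree T I F J F'" "finite I" "finite J"
  shows "counts_agree T I (\<lambda>i. g (F i)) J (\<lambda>j. g (F' j))"
  unfolding counts_agree_def
proof
  fix c
  show "min T (card {i\<in>I. g (F i) = c}) = min T (card {j\<in>J. g (F' j) = c})"
    using counts_agree_pred[OF assms, of "\<lambda>x. g x = c"] .
qed

lemma counts_agree_ex:
  assumes "counts_agree T I F J F'" "finite I" "finite J" "T \<ge> 1"
  shows "(\<exists>i\<in>I. P (F i)) \<longleftrightarrow> (\<exists>j\<in>J. P (F' j))"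
proof -
  have *: "(\<exists>i\<in>K. P (H i)) \<longleftrightarrow> min T (card {i\<in>K. P (H i)}) \<noteq> 0" if "finite K"
    for K and H :: "'d \<Rightarrow> 'b"
  proof -
    have "min T (card {i\<in>K. P (H i)}) \<noteq> 0 \<longleftrightarrow> card {i\<in>K. P (H i)} \<noteq> 0"
      using assms(4) by (simp add: min_def)
    also have "\<dots> \<longleftrightarrow> {i\<in>K. P (H i)} \<noteq> {}" using that by simp
    finally show ?thesis by blast
  qed
  show ?thesis
    using counts_agree_pred[OF assms(1-3), of P] assms(2,3) by (simp add: *)
qed

text \<open>The combinatorial core of an answer in the game: \<open>A\<close> is the labelling
  produced by a move, and \<open>colouring_transfer\<close> answers it inside each colour class
  separately.\<close>

lemma counts_agree_refine:
  assumes "counts_agree (card C * T) I F J F'" "finite I" "finite J"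
    and "finite C" "C \<noteq> {}" "A ` I \<subseteq> C"
  shows "\<exists>B. counts_agree T I (\<lambda>i. (F i, A i)) J (\<lambda>j. (F' j, B j)) \<and> B ` J \<subseteq> C"
proof -
  have "\<exists>B. B ` {j\<in>J. F' j = c} \<subseteq> C \<and>
    (\<forall>d\<in>C. min T (card {x\<in>{i\<in>I. F i = c}. A x = d}) = min T (card {y\<in>{j\<in>J. F' j = c}. B y = d}))"
    for c
    using assms by (intro colouring_transfer) (auto simp: counts_agree_def)
  then have "\<forall>c. \<exists>B. B ` {j\<in>J. F' j = c} \<subseteq> C \<and>
    (\<forall>d\<in>C. min T (card {x\<in>{i\<in>I. F i = c}. A x = d}) = min T (card {y\<in>{j\<in>J. F' j = c}. B y = d}))"
    ..
  from choice[OF this] obtain B where B: "\<And>c. B c ` {j\<in>J. F' j = c} \<subseteq> C"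
    "\<And>c d. d \<in> C \<Longrightarrow> min T (card {x\<in>{i\<in>I. F i = c}. A x = d}) =
       min T (card {y\<in>{j\<in>J. F' j = c}. B c y = d})"
    by blast
  let ?B = "\<lambda>j. B (F' j) j"
  have im: "?B ` J \<subseteq> C" using B(1) by blast
  have "min T (card {i\<in>I. (F i, A i) = (c, d)}) = min T (card {j\<in>J. (F' j, ?B j) = (c, d)})" for c d
  proof (cases "d \<in> C")
    case True
    have "{i\<in>I. (F i, A i) = (c, d)} = {x\<in>{i\<in>I. F i = c}. A x = d}"
      "{j\<in>J. (F' j, ?B j) = (c, d)} = {y\<in>{j\<in>J. F' j = c}. B c y = d}" by auto
    then show ?thesis using B(2)[OF True] by simp
  next
    case False
    have "{i\<in>I. (F i, A i) = (c, d)} = {}" "{j\<in>J. (F' j, ?B j) = (c, d)} = {}"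
      using False assms(6) im by auto
    then show ?thesis by (simp only: card.empty)
  qed
  then have "counts_agree T I (\<lambda>i. (F i, A i)) J (\<lambda>j. (F' j, ?B j))"
    unfolding counts_agree_def by (simp only: split_paired_All simp_thms)
  then show ?thesis using im by (intro exI[of _ ?B] conjI)
qed

section \<open>MSO equivalence of decomposed graphs\<close>

text \<open>Pulling the induced arcs back along a numbering makes blocks of graphs over different
  vertex types comparable.\<close>

definition block_pattern :: "'a rel \<Rightarrow> nat \<Rightarrow> (nat \<Rightarrow> 'a) \<Rightarrow> nat \<times> nat rel" where
  "block_pattern E h f = (h, {(a, b). a < h \<and> b < h \<and> (f a, f b) \<in> E})"

text \<open>Every block carries a numbering \<open>f i\<close> of its vertices, so that a subset of
  any block becomes a subset of \<open>{..<k}\<close>. This leaves at most 2^k traces.\<close>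

locale block_decomp =
  fixes k :: nat and G :: "'a pair_pre_digraph" and I :: "'i set"
    and h :: "'i \<Rightarrow> nat" and f :: "'i \<Rightarrow> nat \<Rightarrow> 'a"
  assumes finite_blocks: "finite I"
    and block_le: "i \<in> I \<Longrightarrow> h i \<le> k"
    and block_in: "i \<in> I \<Longrightarrow> a < h i \<Longrightarrow> f i a \<in> pverts G"
    and block_inj: "i \<in> I \<Longrightarrow> j \<in> I \<Longrightarrow> a < h i \<Longrightarrow> b < h j \<Longrightarrow> f i a = f j b \<Longrightarrow> i = j \<and> a = b"
    and block_cover: "u \<in> pverts G \<Longrightarrow> \<exists>i\<in>I. \<exists>a<h i. u = f i a"
    and block_arcs: "(u, w) \<in> parcs G \<Longrightarrow> \<exists>i\<in>I. \<exists>a<h i. \<exists>b<h i. u = f i a \<and> w = f i b"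
begin

definition set_trace :: "'a set \<Rightarrow> 'i \<Rightarrow> nat set" where
  "set_trace A i = {a. a < h i \<and> f i a \<in> A}"

text \<open>A vertex variable is recorded through the trace of its singleton, which is nonempty in
  at most one block. Vertex moves thus become special set moves.\<close>

definition colour ::
  "(nat \<Rightarrow> 'a) \<Rightarrow> (nat \<Rightarrow> 'a set) \<Rightarrow> 'i \<Rightarrow>
     (nat \<times> nat rel) \<times> (nat \<Rightarrow> nat set) \<times> (nat \<Rightarrow> nat set)" where
  "colour v V i =
     (block_pattern (parcs G) (h i) (f i), (\<lambda>X. set_trace (V X) i), (\<lambda>x. set_trace {v x} i))"

lemma set_trace_subset: "i \<in> I \<Longrightarrow> set_trace A i \<in> Pow {..<k}"
  using block_le by (force simp: set_trace_def)

text \<open>Every atom says that some block has a colour of a certain kind. For adjacency this holds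
  because both ends of an arc lie in one block.\<close>

lemma sat_atoms_iff:
  assumes "range v \<subseteq> pverts G"
  shows "v x = v y \<longleftrightarrow> (\<exists>i\<in>I. (\<lambda>(p, S, s). s x \<inter> s y \<noteq> {}) (colour v V i))"
    and "v x \<in> V X \<longleftrightarrow> (\<exists>i\<in>I. (\<lambda>(p, S, s). s x \<inter> S X \<noteq> {}) (colour v V i))"
    and "(v x, v y) \<in> parcs G \<longleftrightarrow>
      (\<exists>i\<in>I. (\<lambda>(p, S, s). \<exists>a\<in>s x. \<exists>b\<in>s y. (a, b) \<in> snd p) (colour v V i))"
proof -
  have *: "\<exists>i\<in>I. \<exists>a<h i. v x = f i a" for x using assms by (intro block_cover) auto
  show "v x = v y \<longleftrightarrow> (\<exists>i\<in>I. (\<lambda>(p, S, s). s x \<inter> s y \<noteq> {}) (colour v V i))"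
    using *[of x] by (fastforce simp: colour_def set_trace_def)
  show "v x \<in> V X \<longleftrightarrow> (\<exists>i\<in>I. (\<lambda>(p, S, s). s x \<inter> S X \<noteq> {}) (colour v V i))"
    using *[of x] by (fastforce simp: colour_def set_trace_def)
  show "(v x, v y) \<in> parcs G \<longleftrightarrow>
      (\<exists>i\<in>I. (\<lambda>(p, S, s). \<exists>a\<in>s x. \<exists>b\<in>s y. (a, b) \<in> snd p) (colour v V i))"
    using block_arcs[of "v x" "v y"]
    by (fastforce simp: colour_def set_trace_def block_pattern_def)
qed

lemma set_trace_realise:
  assumes "\<And>i. i \<in> I \<Longrightarrow> B i \<subseteq> {..<h i}" "i \<in> I"
  shows "set_trace (\<Union>i\<in>I. f i ` B i) i = B i"
proof (intro equalityI subsetI)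
  fix a assume "a \<in> set_trace (\<Union>i\<in>I. f i ` B i) i"
  then obtain j b where "a < h i" "j \<in> I" "b \<in> B j" "f i a = f j b" by (auto simp: set_trace_def)
  moreover from this have "b < h j" using assms(1) by auto
  ultimately have "i = j \<and> a = b" using assms(2) by (intro block_inj)
  with \<open>b \<in> B j\<close> show "a \<in> B i" by simp
next
  fix a assume "a \<in> B i"
  then show "a \<in> set_trace (\<Union>i\<in>I. f i ` B i) i" using assms by (auto simp: set_trace_def)
qed

lemma realise_in:
  assumes "\<And>i. i \<in> I \<Longrightarrow> B i \<subseteq> {..<h i}"
  shows "(\<Union>i\<in>I. f i ` B i) \<subseteq> pverts G"
proof
  fix u assume "u \<in> (\<Union>i\<in>I. f i ` B i)"
  then obtain i a where "i \<in> I" "a \<in> B i" "u = f i a" by blast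
  with assms[of i] show "u \<in> pverts G" by (auto intro: block_in)
qed

text \<open>The new colour is a fixed function of the old colour and the new trace, so agreement of
  these pairs yields agreement of the new colours.\<close>

lemma colour_update_set:
  "colour v (V(X := A)) i =
    (\<lambda>((p, S, s), B). (p, S(X := B), s)) (colour v V i, set_trace A i)"
  by (auto simp: colour_def fun_eq_iff)

lemma colour_update_vertex:
  "colour (v(x := u)) V i =
    (\<lambda>((p, S, s), B). (p, S, s(x := B))) (colour v V i, set_trace {u} i)"
  by (auto simp: colour_def fun_eq_iff)

end

section \<open>Answering set moves and vertex moves\<close>

lemma block_decomp_transfer_set:
  fixes G :: "'a pair_pre_digraph" and G' :: "'b pair_pre_digraph"
  assumes "block_decomp k G I h f" "block_decomp k G' J h' f'"
    and agree: "counts_agree (2 ^ k * T) I (block_decomp.colour G h f v V)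
       J (block_decomp.colour G' h' f' v' V')"
    and "T \<ge> 1" "A \<subseteq> pverts G"
  obtains A' where "A' \<subseteq> pverts G'"
    "counts_agree T I (\<lambda>i. (block_decomp.colour G h f v V i, block_decomp.set_trace h f A i))
       J (\<lambda>j. (block_decomp.colour G' h' f' v' V' j, block_decomp.set_trace h' f' A' j))"
proof -
  interpret g: block_decomp k G I h f by fact
  interpret g': block_decomp k G' J h' f' by fact
  \<comment> \<open>The traces of \<open>A\<close> label the blocks by elements of
    \<open>Pow {..<k}\<close>; these 2^k labels account for the factor in the hypothesis.\<close>
  have "\<exists>B. counts_agree T I (\<lambda>i. (g.colour v V i, g.set_trace A i))
      J (\<lambda>j. (g'.colour v' V' j, B j)) \<and> B ` J \<subseteq> Pow {..<k}"
    using agree g.finite_blocks g'.finite_blocks g.set_trace_subset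
    by (intro counts_agree_refine) (auto simp: card_Pow)
  then obtain B where B: "counts_agree T I (\<lambda>i. (g.colour v V i, g.set_trace A i))
      J (\<lambda>j. (g'.colour v' V' j, B j))"
    by blast
  have B_sub: "B j \<subseteq> {..<h' j}" if "j \<in> J" for j
  proof -
    \<comment> \<open>A label is a trace only if it fits into its block. The innermost
      \<open>fst\<close> is the block size stored in the colour, so a misfit would be visible in the
      refined colour, and none occurs on the side of \<open>I\<close>.\<close>
    let ?P = "\<lambda>x. \<not> snd x \<subseteq> {..<fst (fst (fst x))}"
    have "\<not> (\<exists>i\<in>I. ?P (g.colour v V i, g.set_trace A i))"
      by (auto simp: g.colour_def g.set_trace_def block_pattern_def)
    then have "\<not> (\<exists>j\<in>J. ?P (g'.colour v' V' j, B j))"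
      using counts_agree_ex[OF B g.finite_blocks g'.finite_blocks \<open>T \<ge> 1\<close>, of ?P] by simp
    then show ?thesis using that by (auto simp: g'.colour_def block_pattern_def)
  qed
  let ?A = "\<Union>j\<in>J. f' j ` B j"
  have eq: "g'.set_trace ?A j = B j" if "j \<in> J" for j
    using B_sub that by (rule g'.set_trace_realise)
  have "{j\<in>J. (g'.colour v' V' j, B j) = c} = {j\<in>J. (g'.colour v' V' j, g'.set_trace ?A j) = c}"
    for c using eq by auto
  with B have "counts_agree T I (\<lambda>i. (g.colour v V i, g.set_trace A i))
      J (\<lambda>j. (g'.colour v' V' j, g'.set_trace ?A j))"
    by (simp add: counts_agree_def)
  moreover have "?A \<subseteq> pverts G'" using B_sub by (rule g'.realise_in)
  ultimately show thesis using that by blast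
qed

text \<open>The move \<open>{u}\<close> is answered by a set \<open>A\<close>, and the counts force
  \<open>A\<close> to be a singleton: exactly one block has a nonempty trace, which is detectable
  because T \<ge> 2, and no trace has two elements.\<close>

lemma block_decomp_transfer_vertex:
  fixes G :: "'a pair_pre_digraph" and G' :: "'b pair_pre_digraph"
  assumes "block_decomp k G I h f" "block_decomp k G' J h' f'"
    and agree: "counts_agree (2 ^ k * T) I (block_decomp.colour G h f v V)
       J (block_decomp.colour G' h' f' v' V')"
    and T: "T \<ge> 2" and u: "u \<in> pverts G"
  obtains u' where "u' \<in> pverts G'"
    "counts_agree T I (\<lambda>i. (block_decomp.colour G h f v V i, block_decomp.set_trace h f {u} i))
       J (\<lambda>j. (block_decomp.colour G' h' f' v' V' j, block_decomp.set_trace h' f' {u'} j))"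
proof -
  interpret g: block_decomp k G I h f by fact
  interpret g': block_decomp k G' J h' f' by fact
  obtain A where A: "A \<subseteq> pverts G'"
    "counts_agree T I (\<lambda>i. (g.colour v V i, g.set_trace {u} i))
       J (\<lambda>j. (g'.colour v' V' j, g'.set_trace A j))"
    using block_decomp_transfer_set[OF assms(1-3), of "{u}"] T u by auto
  obtain i a where ia: "i \<in> I" "a < h i" "u = f i a" using g.block_cover[OF u] by blast
  have "{i\<in>I. g.set_trace {u} i \<noteq> {}} = {i}"
    using ia g.block_inj by (auto simp: g.set_trace_def)
  then have "min T (card {j\<in>J. g'.set_trace A j \<noteq> {}}) = 1"
    using counts_agree_pred[OF A(2) g.finite_blocks g'.finite_blocks, of "\<lambda>(c, D). D \<noteq> {}"] T
    by simp
  then have "card {j\<in>J. g'.set_trace A j \<noteq> {}} = 1" using T by linarith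
  then obtain j where j: "{j\<in>J. g'.set_trace A j \<noteq> {}} = {j}" by (auto simp: card_1_singleton_iff)
  let ?P = "\<lambda>(c, D). D \<noteq> {} \<and> \<not> (\<exists>b. D = {b})"
  have "\<not> (\<exists>i\<in>I. ?P (g.colour v V i, g.set_trace {u} i))"
  proof
    assume "\<exists>i\<in>I. ?P (g.colour v V i, g.set_trace {u} i)"
    then obtain i where "i \<in> I" "g.set_trace {u} i \<noteq> {}" "\<nexists>b. g.set_trace {u} i = {b}" by auto
    then obtain a where i: "i \<in> I" "a \<in> g.set_trace {u} i" "g.set_trace {u} i \<noteq> {a}" by blast
    then obtain b where "b \<in> g.set_trace {u} i" "b \<noteq> a" by blast
    with i show False using g.block_inj[of i i a b] by (simp add: g.set_trace_def)
  qed
  then have "\<not> (\<exists>j\<in>J. ?P (g'.colour v' V' j, g'.set_trace A j))"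
    using counts_agree_ex[OF A(2) g.finite_blocks g'.finite_blocks, of ?P] T by linarith
  moreover have "j \<in> J" "g'.set_trace A j \<noteq> {}" using j by blast+
  ultimately obtain b where b: "g'.set_trace A j = {b}" by auto
  have "A = {f' j b}"
  proof (intro equalityI subsetI)
    fix w assume w: "w \<in> A"
    then obtain i a where ia: "i \<in> J" "a < h' i" "w = f' i a" using A(1) g'.block_cover by blast
    then have "a \<in> g'.set_trace A i" using w by (auto simp: g'.set_trace_def)
    then show "w \<in> {f' j b}" using j b ia by auto
  next
    fix w assume "w \<in> {f' j b}"
    then show "w \<in> A" using b by (auto simp: g'.set_trace_def)
  qed
  then show thesis using that[of "f' j b"] A by simp
qed

lemma block_decomp_update_set:
  fixes G :: "'a pair_pre_digraph" and G' :: "'b pair_pre_digraph"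
  assumes "block_decomp k G I h f" "block_decomp k G' J h' f'"
    and "counts_agree (2 ^ k * T) I (block_decomp.colour G h f v V)
       J (block_decomp.colour G' h' f' v' V')"
    and "T \<ge> 1" "A \<subseteq> pverts G"
  obtains A' where "A' \<subseteq> pverts G'"
    "counts_agree T I (block_decomp.colour G h f v (V(X := A)))
       J (block_decomp.colour G' h' f' v' (V'(X := A')))"
proof -
  obtain A' where A': "A' \<subseteq> pverts G'"
    "counts_agree T I (\<lambda>i. (block_decomp.colour G h f v V i, block_decomp.set_trace h f A i))
       J (\<lambda>j. (block_decomp.colour G' h' f' v' V' j, block_decomp.set_trace h' f' A' j))"
    using block_decomp_transfer_set[OF assms] .
  show thesis
    using counts_agree_comp[OF A'(2) assms(1,2)[THEN block_decomp.finite_blocks],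
        of "\<lambda>((p, S, s), B). (p, S(X := B), s)"]
    by (intro that[OF A'(1)])
      (simp only: assms(1,2)[THEN block_decomp.colour_update_set, abs_def])
qed

lemma block_decomp_update_vertex:
  fixes G :: "'a pair_pre_digraph" and G' :: "'b pair_pre_digraph"
  assumes "block_decomp k G I h f" "block_decomp k G' J h' f'"
    and "counts_agree (2 ^ k * T) I (block_decomp.colour G h f v V)
       J (block_decomp.colour G' h' f' v' V')"
    and "T \<ge> 2" "u \<in> pverts G"
  obtains u' where "u' \<in> pverts G'"
    "counts_agree T I (block_decomp.colour G h f (v(x := u)) V)
       J (block_decomp.colour G' h' f' (v'(x := u')) V')"
proof -
  obtain u' where u': "u' \<in> pverts G'"
    "counts_agree T I (\<lambda>i. (block_decomp.colour G h f v V i, block_decomp.set_trace h f {u} i))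
       J (\<lambda>j. (block_decomp.colour G' h' f' v' V' j, block_decomp.set_trace h' f' {u'} j))"
    using block_decomp_transfer_vertex[OF assms] .
  show thesis
    using counts_agree_comp[OF u'(2) assms(1,2)[THEN block_decomp.finite_blocks],
        of "\<lambda>((p, S, s), B). (p, S, s(x := B))"]
    by (intro that[OF u'(1)])
      (simp only: assms(1,2)[THEN block_decomp.colour_update_vertex, abs_def])
qed

text \<open>
  A quantifier splits every colour class into at most \<open>2 ^ k\<close> pieces. The base value is \<open>2\<close>
  rather than \<open>1\<close> so that a colour occurring exactly once can be recognised.
\<close>

fun threshold :: "nat \<Rightarrow> mso \<Rightarrow> nat" where
  "threshold k (Neg \<phi>) = threshold k \<phi>"
| "threshold k (Conj \<phi> \<psi>) = max (threshold k \<phi>) (threshold k \<psi>)"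
| "threshold k (ExV x \<phi>) = 2 ^ k * threshold k \<phi>"
| "threshold k (ExS X \<phi>) = 2 ^ k * threshold k \<phi>"
| "threshold k _ = 2"

lemma threshold_ge_2: "threshold k \<phi> \<ge> 2"
proof -
  have "2 \<le> 2 ^ k * n" if "2 \<le> n" for n :: nat
    using mult_le_mono[of 1 "2 ^ k" 2 n] that by simp
  then show ?thesis by (induction \<phi>) auto
qed

text \<open>Atoms are decided by which colours occur, and a quantifier is one move, answered in
  either direction since agreement is symmetric. The assignments must take values in the graphs
  because atoms locate a vertex by its trace.\<close>

lemma mso_sat_transfer:
  fixes G :: "'a pair_pre_digraph" and G' :: "'b pair_pre_digraph"
  assumes dec: "block_decomp k G I h f" "block_decomp k G' J h' f'"
    and "counts_agree (threshold k \<phi>) I (block_decomp.colour G h f v V)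
       J (block_decomp.colour G' h' f' v' V')"
    and "range v \<subseteq> pverts G" "range v' \<subseteq> pverts G'"
  shows "mso_sat G v V \<phi> \<longleftrightarrow> mso_sat G' v' V' \<phi>"
  using assms(3-)
proof (induction \<phi> arbitrary: v V v' V')
  case (Eq x y)
  have agree: "counts_agree 2 I (block_decomp.colour G h f v V) J (block_decomp.colour G' h' f' v' V')"
    using Eq.prems(1) by simp
  have "mso_sat G v V (Eq x y) \<longleftrightarrow>
      (\<exists>i\<in>I. (\<lambda>(p, S, s). s x \<inter> s y \<noteq> {}) (block_decomp.colour G h f v V i))"
    unfolding mso_sat.simps using Eq.prems(2) by (rule block_decomp.sat_atoms_iff(1)[OF dec(1)])
  moreover have "mso_sat G' v' V' (Eq x y) \<longleftrightarrow>
      (\<exists>j\<in>J. (\<lambda>(p, S, s). s x \<inter> s y \<noteq> {}) (block_decomp.colour G' h' f' v' V' j))"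
    unfolding mso_sat.simps using Eq.prems(3) by (rule block_decomp.sat_atoms_iff(1)[OF dec(2)])
  ultimately show ?case
    using counts_agree_ex[OF agree dec[THEN block_decomp.finite_blocks],
      where P = "\<lambda>(p, S, s). s x \<inter> s y \<noteq> {}"] by simp
next
  case (Adj x y)
  have agree: "counts_agree 2 I (block_decomp.colour G h f v V) J (block_decomp.colour G' h' f' v' V')"
    using Adj.prems(1) by simp
  have "mso_sat G v V (Adj x y) \<longleftrightarrow>
      (\<exists>i\<in>I. (\<lambda>(p, S, s). \<exists>a\<in>s x. \<exists>b\<in>s y. (a, b) \<in> snd p) (block_decomp.colour G h f v V i))"
    unfolding mso_sat.simps using Adj.prems(2) by (rule block_decomp.sat_atoms_iff(3)[OF dec(1)])
  moreover have "mso_sat G' v' V' (Adj x y) \<longleftrightarrow>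
      (\<exists>j\<in>J. (\<lambda>(p, S, s). \<exists>a\<in>s x. \<exists>b\<in>s y. (a, b) \<in> snd p) (block_decomp.colour G' h' f' v' V' j))"
    unfolding mso_sat.simps using Adj.prems(3) by (rule block_decomp.sat_atoms_iff(3)[OF dec(2)])
  ultimately show ?case
    using counts_agree_ex[OF agree dec[THEN block_decomp.finite_blocks],
      where P = "\<lambda>(p, S, s). \<exists>a\<in>s x. \<exists>b\<in>s y. (a, b) \<in> snd p"] by simp
next
  case (Mem x X)
  have agree: "counts_agree 2 I (block_decomp.colour G h f v V) J (block_decomp.colour G' h' f' v' V')"
    using Mem.prems(1) by simp
  have "mso_sat G v V (Mem x X) \<longleftrightarrow>
      (\<exists>i\<in>I. (\<lambda>(p, S, s). s x \<inter> S X \<noteq> {}) (block_decomp.colour G h f v V i))"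
    unfolding mso_sat.simps using Mem.prems(2) by (rule block_decomp.sat_atoms_iff(2)[OF dec(1)])
  moreover have "mso_sat G' v' V' (Mem x X) \<longleftrightarrow>
      (\<exists>j\<in>J. (\<lambda>(p, S, s). s x \<inter> S X \<noteq> {}) (block_decomp.colour G' h' f' v' V' j))"
    unfolding mso_sat.simps using Mem.prems(3) by (rule block_decomp.sat_atoms_iff(2)[OF dec(2)])
  ultimately show ?case
    using counts_agree_ex[OF agree dec[THEN block_decomp.finite_blocks],
      where P = "\<lambda>(p, S, s). s x \<inter> S X \<noteq> {}"] by simp
next
  case (Neg \<phi>)
  then show ?case by simp
next
  case (Conj \<phi> \<psi>)
  have "counts_agree (threshold k \<phi>) I (block_decomp.colour G h f v V)
      J (block_decomp.colour G' h' f' v' V')"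
    "counts_agree (threshold k \<psi>) I (block_decomp.colour G h f v V)
      J (block_decomp.colour G' h' f' v' V')"
    using Conj.prems(1) by (auto intro: counts_agree_mono)
  then show ?case using Conj.IH[of v V v' V'] Conj.prems(2,3) by simp
next
  case (ExS X \<phi>)
  have T: "threshold k \<phi> \<ge> 1" using threshold_ge_2[of k \<phi>] by simp
  have agree: "counts_agree (2 ^ k * threshold k \<phi>) I (block_decomp.colour G h f v V)
     J (block_decomp.colour G' h' f' v' V')"
    using ExS.prems(1) by simp
  show ?case
  proof
    assume "mso_sat G v V (ExS X \<phi>)"
    then obtain A where A: "A \<subseteq> pverts G" "mso_sat G v (V(X := A)) \<phi>" by auto
    obtain A' where A': "A' \<subseteq> pverts G'" "counts_agree (threshold k \<phi>)
        I (block_decomp.colour G h f v (V(X := A))) J (block_decomp.colour G' h' f' v' (V'(X := A')))"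
      using block_decomp_update_set[OF dec agree T A(1)] by blast
    then show "mso_sat G' v' V' (ExS X \<phi>)"
      using A'(1) iffD1[OF ExS.IH[OF A'(2) ExS.prems(2,3)] A(2)]
      unfolding mso_sat.simps by blast
  next
    assume "mso_sat G' v' V' (ExS X \<phi>)"
    then obtain A' where A': "A' \<subseteq> pverts G'" "mso_sat G' v' (V'(X := A')) \<phi>" by auto
    obtain A where A: "A \<subseteq> pverts G" "counts_agree (threshold k \<phi>)
        J (block_decomp.colour G' h' f' v' (V'(X := A'))) I (block_decomp.colour G h f v (V(X := A)))"
      using block_decomp_update_set[OF dec(2,1) counts_agree_sym[OF agree] T A'(1)] by blast
    then show "mso_sat G v V (ExS X \<phi>)"
      using A(1) iffD2[OF ExS.IH[OF counts_agree_sym[OF A(2)] ExS.prems(2,3)] A'(2)]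
      unfolding mso_sat.simps by blast
  qed
next
  case (ExV x \<phi>)
  note T = threshold_ge_2[of k \<phi>]
  have agree: "counts_agree (2 ^ k * threshold k \<phi>) I (block_decomp.colour G h f v V)
     J (block_decomp.colour G' h' f' v' V')"
    using ExV.prems(1) by simp
  show ?case
  proof
    assume "mso_sat G v V (ExV x \<phi>)"
    then obtain u where u: "u \<in> pverts G" "mso_sat G (v(x := u)) V \<phi>" by auto
    obtain u' where u': "u' \<in> pverts G'" "counts_agree (threshold k \<phi>)
        I (block_decomp.colour G h f (v(x := u)) V) J (block_decomp.colour G' h' f' (v'(x := u')) V')"
      using block_decomp_update_vertex[OF dec agree T u(1)] by blast
    have rng: "range (v(x := u)) \<subseteq> pverts G" "range (v'(x := u')) \<subseteq> pverts G'"
      using ExV.prems(2,3) u(1) u'(1) by auto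
    then show "mso_sat G' v' V' (ExV x \<phi>)"
      using u'(1) iffD1[OF ExV.IH[OF u'(2) rng] u(2)]
      unfolding mso_sat.simps by blast
  next
    assume "mso_sat G' v' V' (ExV x \<phi>)"
    then obtain u' where u': "u' \<in> pverts G'" "mso_sat G' (v'(x := u')) V' \<phi>" by auto
    obtain u where u: "u \<in> pverts G" "counts_agree (threshold k \<phi>)
        J (block_decomp.colour G' h' f' (v'(x := u')) V') I (block_decomp.colour G h f (v(x := u)) V)"
      using block_decomp_update_vertex[OF dec(2,1) counts_agree_sym[OF agree] T u'(1)] by blast
    have rng: "range (v(x := u)) \<subseteq> pverts G" "range (v'(x := u')) \<subseteq> pverts G'"
      using ExV.prems(2,3) u(1) u'(1) by auto
    then show "mso_sat G v V (ExV x \<phi>)"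
      using u(1) iffD2[OF ExV.IH[OF counts_agree_sym[OF u(2)] rng] u'(2)]
      unfolding mso_sat.simps by blast
  qed
qed

text \<open>Before any move there are no corresponding vertices to serve as initial assignments with
  values in the graphs. One preliminary vertex move supplies them and costs the additional factor
  2^k.\<close>

lemma mso_models_transfer:
  fixes G :: "'a pair_pre_digraph" and G' :: "'b pair_pre_digraph"
  assumes "mso_sentence \<phi>"
    and dec: "block_decomp k G I h f" "block_decomp k G' J h' f'"
    and agree: "counts_agree (2 ^ k * threshold k \<phi>)
      I (\<lambda>i. block_pattern (parcs G) (h i) (f i)) J (\<lambda>j. block_pattern (parcs G') (h' j) (f' j))"
    and u: "u \<in> pverts G" and w: "w \<notin> pverts G" "w' \<notin> pverts G'"
  shows "mso_models G \<phi> \<longleftrightarrow> mso_models G' \<phi>"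
proof -
  interpret g: block_decomp k G I h f by fact
  interpret g': block_decomp k G' J h' f' by fact
  note fin = g.finite_blocks g'.finite_blocks
  \<comment> \<open>The assignments \<open>\<lambda>_. w\<close> take values outside the graph, so that they leave no trace.\<close>
  have "{i\<in>I. g.colour (\<lambda>_. w) (\<lambda>_. {}) i = c} =
      {i\<in>I. (block_pattern (parcs G) (h i) (f i), (\<lambda>_. {}), (\<lambda>_. {})) = c}" for c
    using w(1) g.block_in by (auto simp: g.colour_def g.set_trace_def)
  moreover have "{j\<in>J. g'.colour (\<lambda>_. w') (\<lambda>_. {}) j = c} =
      {j\<in>J. (block_pattern (parcs G') (h' j) (f' j), (\<lambda>_. {}), (\<lambda>_. {})) = c}" for c
    using w(2) g'.block_in by (auto simp: g'.colour_def g'.set_trace_def)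
  ultimately have "counts_agree (2 ^ k * threshold k \<phi>)
      I (g.colour (\<lambda>_. w) (\<lambda>_. {})) J (g'.colour (\<lambda>_. w') (\<lambda>_. {}))"
    using counts_agree_comp[OF agree fin, of "\<lambda>p. (p, (\<lambda>_. {}), (\<lambda>_. {}))"]
    unfolding counts_agree_def by simp
  from block_decomp_transfer_vertex[OF dec this threshold_ge_2 u]
  obtain u' where u': "u' \<in> pverts G'"
    "counts_agree (threshold k \<phi>) I (\<lambda>i. (g.colour (\<lambda>_. w) (\<lambda>_. {}) i, g.set_trace {u} i))
       J (\<lambda>j. (g'.colour (\<lambda>_. w') (\<lambda>_. {}) j, g'.set_trace {u'} j))" .
  \<comment> \<open>All vertex variables are set to the chosen vertex at once, hence the constant
    function in the last component.\<close>
  have "counts_agree (threshold k \<phi>) I (g.colour (\<lambda>_. u) (\<lambda>_. {})) J (g'.colour (\<lambda>_. u') (\<lambda>_. {}))"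
    using counts_agree_comp[OF u'(2) fin, of "\<lambda>((p, S, s), B). (p, S, \<lambda>_. B)"]
    by (simp add: g.colour_def[abs_def] g'.colour_def[abs_def])
  from mso_sat_transfer[OF dec this] u u'(1) show ?thesis
    unfolding mso_models_iff_sat[OF assms(1), of G "\<lambda>_. u" "\<lambda>_. {}"]
      mso_models_iff_sat[OF assms(1), of G' "\<lambda>_. u'" "\<lambda>_. {}"] by auto
qed

section \<open>Arc sets with bounded components\<close>

definition bounded_arcs :: "nat \<Rightarrow> 'a set \<Rightarrow> 'a rel set" where
  "bounded_arcs k V =
     {E. E \<subseteq> V \<times> V \<and> sym E \<and> irrefl E \<and> (\<forall>u\<in>V. card (E\<^sup>* `` {u}) \<le> k)}"

section \<open>From maximal connected subgraphs to reachability classes\<close>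

lemma rtrancl_on_eq_rtrancl:
  assumes "E \<subseteq> V \<times> V" "u \<in> V"
  shows "(u, w) \<in> rtrancl_on V E \<longleftrightarrow> (u, w) \<in> E\<^sup>*"
proof
  assume "(u, w) \<in> E\<^sup>*"
  then show "(u, w) \<in> rtrancl_on V E"
    by induction (use assms in \<open>auto intro: rtrancl_on_into_rtrancl_on\<close>)
qed (rule rtrancl_on_rtranclI)

lemma reach_subset:
  assumes "E \<subseteq> V \<times> V" "u \<in> V"
  shows "E\<^sup>* `` {u} \<subseteq> V"
  using assms Image_closed_trancl[of E V] by blast

lemma connected_compatible_subgraph:
  assumes "subgraph H (with_proj G)" "Digraph_Component.connected H" "sym (parcs G)"
    and "u \<in> verts H" "w \<in> verts H"
  shows "(u, w) \<in> (parcs G)\<^sup>*"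
proof -
  have "parcs (mk_symmetric H) \<subseteq> parcs G"
    using assms(1,3) by (auto simp: parcs_mk_symmetric subgraph_def compatible_def dest: symD)
  moreover have "(u, w) \<in> rtrancl_on (verts H) (parcs (mk_symmetric H))"
    using assms(2,4,5) by (auto simp: connected_def strongly_connected_def reachable_def)
  then have "(u, w) \<in> (parcs (mk_symmetric H))\<^sup>*" by (rule rtrancl_on_rtranclI)
  ultimately show ?thesis using rtrancl_mono[of "parcs (mk_symmetric H)" "parcs G"] by blast
qed

text \<open>A connected subgraph extending the class contains \<open>u\<close>, so its vertices are
  reachable from \<open>u\<close> and lie in the class. Its arcs then lie in the restriction of
  \<open>E\<close> to the class as well.\<close>

lemma component_of_vertex:
  assumes "E \<subseteq> V \<times> V" "sym E" "u \<in> V"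
  shows "is_component (with_proj \<lparr>pverts = E\<^sup>* `` {u}, parcs = E \<inter> (E\<^sup>* `` {u}) \<times> (E\<^sup>* `` {u})\<rparr>)
     \<lparr>pverts = V, parcs = E\<rparr>" (is "is_component (with_proj ?H) ?G")
proof -
  let ?C = "E\<^sup>* `` {u}"
  have sub: "subgraph ?H ?G"
    using reach_subset[OF assms(1,3)] assms(1)
    by (auto simp: subgraph_def wf_digraph_def)
  have F: "parcs (mk_symmetric (with_proj ?H)) = E \<inter> ?C \<times> ?C"
    using assms(2) by (auto simp: parcs_mk_symmetric dest: symD)
  \<comment> \<open>A path from \<open>u\<close> never leaves the class, so all its arcs survive the
    restriction.\<close>
  have from_u: "(u, w) \<in> (E \<inter> ?C \<times> ?C)\<^sup>*" if "(u, w) \<in> E\<^sup>*" for w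
    using that
  proof induction
    case (step y z)
    then have "(y, z) \<in> E \<inter> ?C \<times> ?C" by (auto intro: rtrancl_into_rtrancl)
    with step.IH show ?case by (rule rtrancl_into_rtrancl)
  qed simp
  have "sym ((E \<inter> ?C \<times> ?C)\<^sup>*)"
    using assms(2) by (intro sym_rtrancl) (auto simp: sym_def)
  then have "(v, w) \<in> (E \<inter> ?C \<times> ?C)\<^sup>*" if "v \<in> ?C" "w \<in> ?C" for v w
    using that from_u by (meson Image_singleton_iff rtrancl_trans symD)
  then have "Digraph_Component.connected (with_proj ?H)"
    unfolding connected_def
    by (intro strongly_connectedI)
      (auto simp: reachable_def F rtrancl_on_eq_rtrancl[where V = ?C])
  moreover have "H' = with_proj ?H" if H': "subgraph ?H H'" "subgraph H' ?G"
    "Digraph_Component.connected H'" for H'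
  proof -
    have "u \<in> verts H'" using H'(1) by (auto simp: subgraph_def)
    then have "verts H' \<subseteq> ?C"
      using connected_compatible_subgraph[OF H'(2,3)] assms(2) by auto
    moreover have ends: "tail H' = fst" "head H' = snd" and sub': "arcs H' \<subseteq> E" and "wf_digraph H'"
      using H'(2) by (auto simp: subgraph_def compatible_def)
    moreover have "arcs H' \<subseteq> verts H' \<times> verts H'"
      using wf_digraph.tail_in_verts[OF \<open>wf_digraph H'\<close>] wf_digraph.head_in_verts[OF \<open>wf_digraph H'\<close>]
      unfolding ends by auto
    moreover have "?C \<subseteq> verts H'" "E \<inter> ?C \<times> ?C \<subseteq> arcs H'"
      using H'(1) by (auto simp: subgraph_def)
    ultimately have "verts H' = ?C" "arcs H' = E \<inter> ?C \<times> ?C" by blast+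
    then show ?thesis using ends by (intro pre_digraph.equality) simp_all
  qed
  ultimately show ?thesis
    using sub unfolding is_component_def pre_digraph.max_subgraph_def by blast
qed

text \<open>Each reachability class spans a component by \<open>component_of_vertex\<close>;
  conversely a nonempty component lies in the class of any of its vertices.\<close>

lemma bounded_component_graphs_on_eq:
  "bounded_component_graphs_on k n =
     (\<lambda>E. \<lparr>pverts = {1..n}, parcs = E\<rparr>) ` bounded_arcs k {1..n}"
proof (intro equalityI subsetI)
  fix G assume "G \<in> bounded_component_graphs_on k n"
  then have G: "pair_graph G" "pverts G = {1..n}"
    and comp: "\<And>H. is_component H G \<Longrightarrow> card (verts H) \<le> k"
    by (auto simp: bounded_component_graphs_on_def bounded_component_graphs_def)
  interpret pair_graph G by (rule G)
  have eq: "G = \<lparr>pverts = {1..n}, parcs = parcs G\<rparr>" using G(2) by simp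
  have sub: "parcs G \<subseteq> {1..n} \<times> {1..n}"
    unfolding G(2)[symmetric] by (auto dest: in_arcsD1 in_arcsD2)
  have sym: "sym (parcs G)" using pair_sym_arcs by (simp add: symmetric_def)
  have "irrefl (parcs G)" using pair_no_loops by (fastforce simp: irrefl_def)
  moreover have "card ((parcs G)\<^sup>* `` {u}) \<le> k" if "u \<in> {1..n}" for u
    using comp[OF component_of_vertex[OF sub sym that, folded eq]] by simp
  ultimately have "parcs G \<in> bounded_arcs k {1..n}"
    using sub sym by (simp add: bounded_arcs_def)
  then show "G \<in> (\<lambda>E. \<lparr>pverts = {1..n}, parcs = E\<rparr>) ` bounded_arcs k {1..n}"
    using eq by blast
next
  fix G assume "G \<in> (\<lambda>E. \<lparr>pverts = {1..n}, parcs = E\<rparr>) ` bounded_arcs k {1..n}"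
  then obtain E where G: "G = \<lparr>pverts = {1..n}, parcs = E\<rparr>" and E: "E \<in> bounded_arcs k {1..n}"
    by blast
  have sub: "E \<subseteq> {1..n} \<times> {1..n}" and sym: "sym E" and irr: "irrefl E"
    and card: "\<And>u. u \<in> {1..n} \<Longrightarrow> card (E\<^sup>* `` {u}) \<le> k"
    using E by (auto simp: bounded_arcs_def)
  have "finite E" using sub by (rule finite_subset) simp
  then have "pair_graph G"
    unfolding G using sub sym irr
    by unfold_locales (auto simp: symmetric_def irrefl_def)
  moreover have "card (verts H) \<le> k" if "is_component H G" for H
  proof (cases "verts H = {}")
    case False
    have H: "subgraph H (with_proj G)" "Digraph_Component.connected H"
      using that by (auto simp: is_component_def pre_digraph.max_subgraph_def)
    obtain u where u: "u \<in> verts H" using False by blast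
    have un: "u \<in> {1..n}" using H(1) u by (auto simp: subgraph_def G)
    have "verts H \<subseteq> E\<^sup>* `` {u}"
      using connected_compatible_subgraph[OF H] u sym by (auto simp: G)
    moreover have "finite (E\<^sup>* `` {u})"
      using reach_subset[OF sub un] by (rule finite_subset) simp
    ultimately have "card (verts H) \<le> card (E\<^sup>* `` {u})" by (intro card_mono)
    then show ?thesis using card[OF un] by (rule le_trans)
  qed simp
  ultimately show "G \<in> bounded_component_graphs_on k n"
    by (simp add: bounded_component_graphs_on_def bounded_component_graphs_def G)
qed

lemma finite_bounded_arcs: "finite V \<Longrightarrow> finite (bounded_arcs k V)"
  by (rule finite_subset[of _ "Pow (V \<times> V)"]) (auto simp: bounded_arcs_def)

lemma empty_in_bounded_arcs: "k \<ge> 1 \<Longrightarrow> {} \<in> bounded_arcs k V"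
  by (auto simp: bounded_arcs_def irrefl_def sym_def)

lemma prob_random_graph:
  assumes "k \<ge> 1"
  shows "measure_pmf.prob (random_graph k n) {G. P G} =
    measure_pmf.prob (pmf_of_set (bounded_arcs k {1..n})) {E. P \<lparr>pverts = {1..n}, parcs = E\<rparr>}"
proof -
  have "random_graph k n =
    map_pmf (\<lambda>E. \<lparr>pverts = {1..n}, parcs = E\<rparr>) (pmf_of_set (bounded_arcs k {1..n}))"
    unfolding random_graph_def bounded_component_graphs_on_eq
    using empty_in_bounded_arcs[OF assms] finite_bounded_arcs
    by (subst map_pmf_of_set_inj) (auto simp: inj_on_def)
  then show ?thesis by (simp add: vimage_def)
qed

section \<open>Components, isolated vertices and the first switching\<close>

definition components :: "'a set \<Rightarrow> 'a rel \<Rightarrow> 'a set set" where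
  "components V E = (\<lambda>u. E\<^sup>* `` {u}) ` V"

definition isolated :: "'a set \<Rightarrow> 'a rel \<Rightarrow> 'a set" where
  "isolated V E = {u\<in>V. E `` {u} = {}}"

lemma rtrancl_class_eq:
  assumes "sym E" "(u, w) \<in> E\<^sup>*"
  shows "E\<^sup>* `` {u} = E\<^sup>* `` {w}"
proof -
  have "(w, u) \<in> E\<^sup>*" using assms sym_rtrancl by (blast dest: symD)
  then show ?thesis using assms(2) by (blast intro: rtrancl_trans)
qed

lemma component_closed:
  assumes "C \<in> components V E" "u \<in> C" "sym E" "(u, w) \<in> E \<or> (w, u) \<in> E"
  shows "w \<in> C"
proof -
  have "(u, w) \<in> E" using assms by (auto dest: symD)
  then show ?thesis using assms(1,2) by (auto simp: components_def intro: rtrancl_into_rtrancl)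
qed

lemma card_le_components:
  assumes "finite V" "E \<in> bounded_arcs k V"
  shows "card V \<le> k * card (components V E)"
proof -
  have "V \<subseteq> \<Union> (components V E)" by (auto simp: components_def)
  moreover have fin: "finite C" if "C \<in> components V E" for C
  proof (rule finite_subset[OF _ assms(1)])
    show "C \<subseteq> V"
      using that assms reach_subset[of E V] unfolding components_def bounded_arcs_def by blast
  qed
  moreover have "finite (components V E)" using assms by (simp add: components_def)
  ultimately have "card V \<le> card (\<Union> (components V E))" by (intro card_mono) auto
  also have "\<dots> \<le> (\<Sum>C\<in>components V E. card C)" by (rule card_Union_le_sum_card)
  also have "\<dots> \<le> (\<Sum>C\<in>components V E. k)"
    using assms(2) by (intro sum_mono) (auto simp: components_def bounded_arcs_def)
  finally show ?thesis by (simp add: mult.commute)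
qed

lemma bounded_arcs_mono:
  assumes "finite V" "E \<in> bounded_arcs k V" "F \<subseteq> E" "sym F"
  shows "F \<in> bounded_arcs k V"
proof -
  have "card (F\<^sup>* `` {u}) \<le> k" if "u \<in> V" for u
  proof -
    have "E\<^sup>* `` {u} \<subseteq> V" using assms that by (intro reach_subset) (auto simp: bounded_arcs_def)
    then have "finite (E\<^sup>* `` {u})" using assms(1) by (rule finite_subset)
    then have "card (F\<^sup>* `` {u}) \<le> card (E\<^sup>* `` {u})"
      using rtrancl_mono[OF assms(3)] by (intro card_mono) auto
    also have "\<dots> \<le> k" using assms(2) that by (simp add: bounded_arcs_def)
    finally show ?thesis .
  qed
  then show ?thesis using assms by (auto simp: bounded_arcs_def irrefl_def)
qed

text \<open>
  Deleting all arcs of one component turns its vertices into isolated ones. There are at least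
  \<open>card V / k\<close> components to choose from, while the deleted component is a subset of the few isolated
  vertices of the result.
\<close>

lemma few_isolated_bound:
  assumes fin: "finite V"
  shows "card V * card {E \<in> bounded_arcs k V. card (isolated V E) \<le> m}
    \<le> k * 2 ^ ((m + k) + (m + k) * (m + k)) * card (bounded_arcs k V)"
proof -
  let ?A = "{E \<in> bounded_arcs k V. card (isolated V E) \<le> m}"
  let ?P = "SIGMA E:?A. components V E"
  \<comment> \<open>At most \<open>m\<close> isolated vertices and at most \<open>k\<close> vertices
    of the deleted component give the bound t = m + k. A record in \<open>?Q\<close> is a subset of
    these vertices and a relation on them, whence 2^(t + t * t).\<close>
  let ?B = "{E \<in> bounded_arcs k V. card (isolated V E) \<le> m + k}"
  let ?Q = "SIGMA E:?B. SIGMA W:Pow (isolated V E). Pow (isolated V E \<times> isolated V E)"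
  let ?f = "\<lambda>(E, W). (E - W \<times> W, W, E \<inter> W \<times> W)"
  have finA: "finite ?A" and finB: "finite ?B" using finite_bounded_arcs[OF fin] by auto
  have fin_iso: "finite (isolated V E)" for E using fin by (simp add: isolated_def)
  have "card V * card ?A = (\<Sum>E\<in>?A. card V)" by simp
  also have "\<dots> \<le> (\<Sum>E\<in>?A. k * card (components V E))"
    using card_le_components[OF fin] by (intro sum_mono) auto
  also have "\<dots> = k * card ?P"
    using finA fin by (subst card_SigmaI) (auto simp: sum_distrib_left components_def)
  also have "card ?P \<le> card ?Q"
  proof (rule card_inj_on_le[of ?f])
    \<comment> \<open>The remaining and the deleted arcs together give \<open>E\<close>
      back.\<close>
    show "inj_on ?f ?P" by (auto simp: inj_on_def)
    show "finite ?Q" using finB fin_iso by (intro finite_SigmaI) auto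
    have "?f (E, W) \<in> ?Q" if E: "E \<in> ?A" and W: "W \<in> components V E" for E W
    proof -
      let ?E = "E - W \<times> W"
      have symE: "sym E" and subE: "E \<subseteq> V \<times> V" using E by (auto simp: bounded_arcs_def)
      have WV: "W \<subseteq> V" using W reach_subset[OF subE] by (auto simp: components_def)
      have "card W \<le> k" using E W by (auto simp: bounded_arcs_def components_def)
      have "sym ?E" using symE by (auto simp: sym_def)
      then have bd: "?E \<in> bounded_arcs k V" using E bounded_arcs_mono[OF fin, of E k ?E] by auto
      have iso: "W \<subseteq> isolated V ?E"
        using component_closed[OF W] symE WV by (auto simp: isolated_def)
      have "isolated V ?E \<subseteq> isolated V E \<union> W" by (auto simp: isolated_def)
      then have "card (isolated V ?E) \<le> card (isolated V E \<union> W)"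
        using finite_subset[OF WV fin] fin_iso by (intro card_mono) simp_all
      also have "\<dots> \<le> m + k"
        using E \<open>card W \<le> k\<close> card_Un_le[of "isolated V E" W] by simp
      finally show ?thesis using bd iso by auto
    qed
    then show "?f ` ?P \<subseteq> ?Q" by auto
  qed
  also have "card ?Q = (\<Sum>E\<in>?B. 2 ^ (card (isolated V E) + card (isolated V E) * card (isolated V E)))"
    using finB fin_iso
    by (subst card_SigmaI) (auto simp: card_Pow card_cartesian_product power_add intro!: sum.cong)
  also have "\<dots> \<le> (\<Sum>E\<in>?B. 2 ^ ((m + k) + (m + k) * (m + k)))"
    by (intro sum_mono power_increasing add_mono mult_mono) auto
  also have "\<dots> \<le> 2 ^ ((m + k) + (m + k) * (m + k)) * card (bounded_arcs k V)"
    using finite_bounded_arcs[OF fin] by (simp add: card_mono)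
  finally show ?thesis by (simp add: mult.assoc)
qed

section \<open>Canonical patterns of components\<close>

definition matches :: "nat \<times> nat rel \<Rightarrow> 'a set \<Rightarrow> 'a rel \<Rightarrow> bool" where
  "matches p C E \<longleftrightarrow> (\<exists>g. bij_betw g {..<fst p} C \<and> block_pattern E (fst p) g = p)"

text \<open>Labelled connected graphs, with isomorphic ones still counted as different.
  Connectedness makes a planted pattern a single component.\<close>

definition patterns :: "nat \<Rightarrow> (nat \<times> nat rel) set" where
  "patterns k = {(h, D). 1 \<le> h \<and> h \<le> k \<and> D \<subseteq> {..<h} \<times> {..<h} \<and> sym D \<and> irrefl D \<and>
     (\<forall>a<h. \<forall>b<h. (a, b) \<in> D\<^sup>*)}"

lemma finite_patterns: "finite (patterns k)"
proof (rule finite_subset)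
  show "patterns k \<subseteq> {..k} \<times> Pow ({..<k} \<times> {..<k})"
  proof
    fix p assume "p \<in> patterns k"
    then obtain h D where p: "p = (h, D)" "h \<le> k" "D \<subseteq> {..<h} \<times> {..<h}" by (auto simp: patterns_def)
    then have "D \<subseteq> {..<k} \<times> {..<k}" by force
    then show "p \<in> {..k} \<times> Pow ({..<k} \<times> {..<k})" using p by simp
  qed
qed simp

text \<open>Two numberings with the same pattern compose to an isomorphism from \<open>C\<close> to
  \<open>C'\<close>, along which every other numbering of \<open>C\<close> can be carried.\<close>

lemma matches_transfer:
  assumes "matches p C E" "matches p C' E'" "matches q C E"
  shows "matches q C' E'"
proof -
  obtain f where f: "bij_betw f {..<fst p} C" "block_pattern E (fst p) f = p"
    using assms(1) by (auto simp: matches_def)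
  obtain g where g: "bij_betw g {..<fst p} C'" "block_pattern E' (fst p) g = p"
    using assms(2) by (auto simp: matches_def)
  obtain e where e: "bij_betw e {..<fst q} C" "block_pattern E (fst q) e = q"
    using assms(3) by (auto simp: matches_def)
  define i where "i = inv_into {..<fst p} f"
  have i: "bij_betw i C {..<fst p}" unfolding i_def using f(1) by (rule bij_betw_inv_into)
  have fi: "f (i x) = x" if "x \<in> C" for x
    unfolding i_def using f(1) that by (rule bij_betw_inv_into_right)
  have fg: "(f a, f b) \<in> E \<longleftrightarrow> (g a, g b) \<in> E'" if "a < fst p" "b < fst p" for a b
  proof -
    have "(a, b) \<in> snd (block_pattern E (fst p) f) \<longleftrightarrow> (a, b) \<in> snd (block_pattern E' (fst p) g)"
      using f(2) g(2) by simp
    then show ?thesis using that by (simp add: block_pattern_def)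
  qed
  have "(e a, e b) \<in> E \<longleftrightarrow> (g (i (e a)), g (i (e b))) \<in> E'" if "a < fst q" "b < fst q" for a b
  proof -
    have C: "e a \<in> C" "e b \<in> C" using e(1) that by (auto simp: bij_betw_def)
    then have "i (e a) < fst p" "i (e b) < fst p" using i by (auto simp: bij_betw_def)
    from fg[OF this] show ?thesis using C by (simp add: fi)
  qed
  then have "block_pattern E' (fst q) (g \<circ> i \<circ> e) = block_pattern E (fst q) e"
    by (auto simp: block_pattern_def)
  moreover have "bij_betw (g \<circ> i \<circ> e) {..<fst q} C'"
    using bij_betw_trans[OF e(1) bij_betw_trans[OF i g(1)]] by (simp add: comp_assoc)
  ultimately show ?thesis unfolding matches_def using e(2) by metis
qed

text \<open>Any numbering of the component will do: a path between two of its vertices cannot leave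
  it, so it pulls back arc by arc to the numbers.\<close>

lemma component_matches_pattern:
  assumes fin: "finite V" and E: "E \<in> bounded_arcs k V" and C: "C \<in> components V E"
  shows "\<exists>p\<in>patterns k. matches p C E"
proof -
  have subE: "E \<subseteq> V \<times> V" and symE: "sym E" and irr: "irrefl E" using E by (auto simp: bounded_arcs_def)
  obtain u where u: "u \<in> V" "C = E\<^sup>* `` {u}" using C by (auto simp: components_def)
  have "finite C" using reach_subset[OF subE u(1)] fin unfolding u(2) by (rule finite_subset)
  then obtain g where g: "bij_betw g {..<card C} C"
    using ex_bij_betw_nat_finite[of C] by (auto simp: atLeast0LessThan)
  define D where "D = snd (block_pattern E (card C) g)"
  have memD: "(a, b) \<in> D \<longleftrightarrow> a < card C \<and> b < card C \<and> (g a, g b) \<in> E" for a b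
    by (simp add: D_def block_pattern_def)
  have "(a, b) \<in> D\<^sup>*" if ab: "a < card C" "b < card C" for a b
  proof -
    have inC: "g a \<in> C" "g b \<in> C" using g ab by (auto simp: bij_betw_def)
    then have path: "(g a, g b) \<in> E\<^sup>*"
      using sym_rtrancl[OF symE] unfolding u(2) by (auto dest: symD intro: rtrancl_trans)
    have "\<exists>c<card C. w = g c \<and> (a, c) \<in> D\<^sup>*" if "(g a, w) \<in> E\<^sup>*" for w
      using that
    proof induction
      case base
      then show ?case using ab by auto
    next
      case (step y z)
      then obtain c where c: "c < card C" "y = g c" "(a, c) \<in> D\<^sup>*" by blast
      have "z \<in> C"
        using component_closed[OF C _ symE] step.hyps(2) c g by (auto simp: bij_betw_def)
      then obtain d where d: "d < card C" "z = g d" using g by (auto simp: bij_betw_def)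
      then have "(c, d) \<in> D" using c step.hyps(2) by (simp add: memD)
      with c(3) have "(a, d) \<in> D\<^sup>*" by (rule rtrancl_into_rtrancl)
      then show ?case using d by blast
    qed
    from this[OF path] obtain c where "c < card C" "g b = g c" "(a, c) \<in> D\<^sup>*" by blast
    then show ?thesis using g ab by (auto simp: bij_betw_def inj_on_def)
  qed
  moreover have "card C \<le> k" using E u by (simp add: bounded_arcs_def)
  moreover have "1 \<le> card C" using \<open>finite C\<close> u by (simp add: Suc_le_eq card_gt_0_iff) blast
  moreover have "D \<subseteq> {..<card C} \<times> {..<card C}" using memD by auto
  moreover have "sym D" "irrefl D" using symE irr by (auto simp: sym_def irrefl_def memD)
  ultimately have "(card C, D) \<in> patterns k" by (simp add: patterns_def)
  moreover have "matches (card C, D) C E"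
    unfolding matches_def using g by (intro exI[of _ g]) (simp add: D_def block_pattern_def)
  ultimately show ?thesis by blast
qed

text \<open>The choice depends only on which patterns are matched, so isomorphic components receive
  the same pattern.\<close>

definition canonical_pattern :: "nat \<Rightarrow> 'a set \<Rightarrow> 'a rel \<Rightarrow> nat \<times> nat rel" where
  "canonical_pattern k C E = (SOME p. p \<in> patterns k \<and> matches p C E)"

text \<open>The patterns selected for their own graph on \<open>{..<fst p}\<close>: one
  representative per isomorphism class.\<close>

definition canonical_patterns :: "nat \<Rightarrow> (nat \<times> nat rel) set" where
  "canonical_patterns k = {p \<in> patterns k. canonical_pattern k {..<fst p} (snd p) = p}"

lemma pattern_matches_self:
  assumes "p \<in> patterns k"
  shows "matches p {..<fst p} (snd p)"
proof -
  have "block_pattern (snd p) (fst p) id = p"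
    using assms by (auto simp: patterns_def block_pattern_def)
  then show ?thesis unfolding matches_def by (intro exI[of _ id] conjI) simp_all
qed

lemma canonical_pattern_cong:
  assumes "matches p C E" "matches p C' E'"
  shows "canonical_pattern k C E = canonical_pattern k C' E'"
proof -
  have "matches q C E \<longleftrightarrow> matches q C' E'" for q
    using matches_transfer[OF assms] matches_transfer[OF assms(2,1)] by (rule iffI)
  then show ?thesis by (simp add: canonical_pattern_def)
qed

lemma canonical_pattern:
  assumes "finite V" "E \<in> bounded_arcs k V" "C \<in> components V E"
  shows "canonical_pattern k C E \<in> canonical_patterns k" "matches (canonical_pattern k C E) C E"
proof -
  let ?p = "canonical_pattern k C E"
  have "\<exists>p. p \<in> patterns k \<and> matches p C E"
    using component_matches_pattern[OF assms] by blast
  then have p: "?p \<in> patterns k \<and> matches ?p C E"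
    unfolding canonical_pattern_def by (rule someI_ex)
  then show "matches ?p C E" by simp
  show "?p \<in> canonical_patterns k"
    using p canonical_pattern_cong[OF pattern_matches_self, of ?p k C E k]
    by (simp add: canonical_patterns_def)
qed

text \<open>This identifies the copies of a canonical pattern with a colour class of
  components.\<close>

lemma canonical_pattern_eq_iff:
  assumes "finite V" "E \<in> bounded_arcs k V" "C \<in> components V E" "p \<in> canonical_patterns k"
  shows "canonical_pattern k C E = p \<longleftrightarrow> matches p C E"
proof
  assume "matches p C E"
  then show "canonical_pattern k C E = p"
    using assms(4) canonical_pattern_cong[OF pattern_matches_self, of p k C E k]
    by (simp add: canonical_patterns_def)
qed (use canonical_pattern(2)[OF assms(1-3)] in auto)

text \<open>Each component is numbered by a witness of matching its canonical pattern, so that block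
  patterns stand for isomorphism types.\<close>

lemma component_decomp:
  assumes fin: "finite V" and E: "E \<in> bounded_arcs k V"
  obtains f where
    "block_decomp k \<lparr>pverts = V, parcs = E\<rparr> (components V E) (\<lambda>C. fst (canonical_pattern k C E)) f"
    "\<And>C. C \<in> components V E \<Longrightarrow>
       block_pattern E (fst (canonical_pattern k C E)) (f C) = canonical_pattern k C E"
proof -
  let ?p = "\<lambda>C. canonical_pattern k C E"
  have subE: "E \<subseteq> V \<times> V" and symE: "sym E" using E by (auto simp: bounded_arcs_def)
  have "\<forall>C\<in>components V E. \<exists>g. bij_betw g {..<fst (?p C)} C \<and> block_pattern E (fst (?p C)) g = ?p C"
    using canonical_pattern(2)[OF fin E] by (simp add: matches_def)
  from bchoice[OF this] obtain f
    where f: "\<And>C. C \<in> components V E \<Longrightarrow> bij_betw (f C) {..<fst (?p C)} C"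
      "\<And>C. C \<in> components V E \<Longrightarrow> block_pattern E (fst (?p C)) (f C) = ?p C"
    by blast
  have in_C: "f C a \<in> C" if "C \<in> components V E" "a < fst (?p C)" for C a
    using f(1)[OF that(1)] that(2) by (auto simp: bij_betw_def)
  have eq_comp: "C = E\<^sup>* `` {u}" if "C \<in> components V E" "u \<in> C" for C u
    using that rtrancl_class_eq[OF symE] by (auto simp: components_def)
  have ex: "\<exists>a<fst (?p C). u = f C a" if "C \<in> components V E" "u \<in> C" for C u
    using f(1)[OF that(1)] that(2) by (auto simp: bij_betw_def)
  have own: "E\<^sup>* `` {u} \<in> components V E" if "u \<in> V" for u
    using that by (simp add: components_def)
  have "block_decomp k \<lparr>pverts = V, parcs = E\<rparr> (components V E) (\<lambda>C. fst (?p C)) f"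
  proof
    show "finite (components V E)" using fin by (simp add: components_def)
  next
    fix C assume "C \<in> components V E"
    then show "fst (?p C) \<le> k"
      using canonical_pattern(1)[OF fin E] by (fastforce simp: canonical_patterns_def patterns_def)
  next
    fix C a assume C: "C \<in> components V E" "a < fst (?p C)"
    have "C \<subseteq> V" using C(1) reach_subset[OF subE] by (auto simp: components_def)
    then show "f C a \<in> pverts \<lparr>pverts = V, parcs = E\<rparr>" using in_C[OF C] by auto
  next
    fix C C' a b
    assume *: "C \<in> components V E" "C' \<in> components V E" "a < fst (?p C)" "b < fst (?p C')"
      "f C a = f C' b"
    have "C = C'" using eq_comp[OF *(1) in_C[OF *(1,3)]] eq_comp[OF *(2) in_C[OF *(2,4)]] *(5) by simp
    then show "C = C' \<and> a = b" using f(1)[OF *(1)] * by (auto simp: bij_betw_def inj_on_def)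
  next
    fix u assume "u \<in> pverts \<lparr>pverts = V, parcs = E\<rparr>"
    then have "u \<in> V" by simp
    from ex[OF own[OF this]] own[OF this]
    show "\<exists>C\<in>components V E. \<exists>a<fst (?p C). u = f C a" by blast
  next
    fix u w assume "(u, w) \<in> parcs \<lparr>pverts = V, parcs = E\<rparr>"
    then have uw: "(u, w) \<in> E" by simp
    then have "u \<in> V" using subE by auto
    note C = own[OF this]
    have "\<exists>a<fst (?p (E\<^sup>* `` {u})). u = f (E\<^sup>* `` {u}) a" using ex[OF C] by blast
    moreover have "\<exists>b<fst (?p (E\<^sup>* `` {u})). w = f (E\<^sup>* `` {u}) b" using ex[OF C] uw by blast
    ultimately show "\<exists>C\<in>components V E. \<exists>a<fst (?p C). \<exists>b<fst (?p C). u = f C a \<and> w = f C b"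
      using C by blast
  qed
  then show thesis using f(2) that by blast
qed

definition copies :: "nat \<times> nat rel \<Rightarrow> 'a set \<Rightarrow> 'a rel \<Rightarrow> 'a set set" where
  "copies p V E = {C \<in> components V E. matches p C E}"

text \<open>Truncated counts agree trivially: canonical patterns reach the cap in both graphs, and
  all other patterns occur in neither.\<close>

lemma mso_models_eq_if_many_copies:
  assumes "mso_sentence \<phi>" "finite V" "finite V'" "V \<noteq> {}"
    and E: "E \<in> bounded_arcs k V" and E': "E' \<in> bounded_arcs k V'"
    and many: "\<And>p. p \<in> canonical_patterns k \<Longrightarrow> 2 ^ k * threshold k \<phi> \<le> card (copies p V E)"
      "\<And>p. p \<in> canonical_patterns k \<Longrightarrow> 2 ^ k * threshold k \<phi> \<le> card (copies p V' E')"
    and w: "w \<notin> V" "w' \<notin> V'"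
  shows "mso_models \<lparr>pverts = V, parcs = E\<rparr> \<phi> \<longleftrightarrow> mso_models \<lparr>pverts = V', parcs = E'\<rparr> \<phi>"
proof -
  let ?R = "2 ^ k * threshold k \<phi>"
  obtain f where f: "block_decomp k \<lparr>pverts = V, parcs = E\<rparr> (components V E)
      (\<lambda>C. fst (canonical_pattern k C E)) f"
    "\<And>C. C \<in> components V E \<Longrightarrow>
       block_pattern E (fst (canonical_pattern k C E)) (f C) = canonical_pattern k C E"
    using component_decomp[OF assms(2) E] by blast
  obtain f' where f': "block_decomp k \<lparr>pverts = V', parcs = E'\<rparr> (components V' E')
      (\<lambda>C. fst (canonical_pattern k C E')) f'"
    "\<And>C. C \<in> components V' E' \<Longrightarrow>
       block_pattern E' (fst (canonical_pattern k C E')) (f' C) = canonical_pattern k C E'"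
    using component_decomp[OF assms(3) E'] by blast
  obtain u where "u \<in> V" using assms(4) by blast
  have "min ?R (card {C\<in>components V E. canonical_pattern k C E = p}) =
      min ?R (card {C\<in>components V' E'. canonical_pattern k C E' = p})" for p
  proof (cases "p \<in> canonical_patterns k")
    case True
    have "{C\<in>components V E. canonical_pattern k C E = p} = copies p V E"
      "{C\<in>components V' E'. canonical_pattern k C E' = p} = copies p V' E'"
      using canonical_pattern_eq_iff[OF assms(2) E _ True] canonical_pattern_eq_iff[OF assms(3) E' _ True]
      by (auto simp: copies_def)
    then show ?thesis using many[OF True] by simp
  next
    case False
    have "{C\<in>components V E. canonical_pattern k C E = p} = {}"
      "{C\<in>components V' E'. canonical_pattern k C E' = p} = {}"
      using canonical_pattern(1)[OF assms(2) E] canonical_pattern(1)[OF assms(3) E'] False by auto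
    then show ?thesis by (simp only: card.empty)
  qed
  moreover have "{C\<in>components V E. block_pattern E (fst (canonical_pattern k C E)) (f C) = p} =
      {C\<in>components V E. canonical_pattern k C E = p}" for p using f(2) by auto
  moreover have "{C\<in>components V' E'. block_pattern E' (fst (canonical_pattern k C E')) (f' C) = p} =
      {C\<in>components V' E'. canonical_pattern k C E' = p}" for p using f'(2) by auto
  ultimately show ?thesis
    using \<open>u \<in> V\<close> w
    by (intro mso_models_transfer[OF assms(1) f(1) f'(1), of u w w']) (simp_all add: counts_agree_def)
qed

section \<open>Planting patterns\<close>

text \<open>The numbering of \<open>W\<close> is fixed by choice, so the planted arcs are a function
  of \<open>p\<close> and \<open>W\<close>.\<close>

definition plant :: "nat \<times> nat rel \<Rightarrow> 'a set \<Rightarrow> 'a rel" where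
  "plant p W = map_prod (SOME g. bij_betw g {..<fst p} W) (SOME g. bij_betw g {..<fst p} W) ` snd p"

lemma plant_properties:
  assumes p: "p \<in> patterns k" and W: "finite W" "card W = fst p"
  shows "plant p W \<subseteq> W \<times> W" "sym (plant p W)" "irrefl (plant p W)"
    and "\<And>u w. u \<in> W \<Longrightarrow> w \<in> W \<Longrightarrow> (u, w) \<in> (plant p W)\<^sup>*"
    and "\<And>E. E \<inter> W \<times> W = {} \<Longrightarrow> matches p W (E \<union> plant p W)"
proof -
  define g where "g = (SOME g. bij_betw g {..<fst p} W)"
  have "\<exists>g. bij_betw g {..<fst p} W"
    using ex_bij_betw_nat_finite[OF W(1)] W(2) by (auto simp: atLeast0LessThan)
  then have g: "bij_betw g {..<fst p} W" unfolding g_def by (rule someI_ex)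
  have plant: "plant p W = map_prod g g ` snd p" by (simp add: plant_def g_def)
  have D: "snd p \<subseteq> {..<fst p} \<times> {..<fst p}" "sym (snd p)" "irrefl (snd p)"
    "\<And>a b. a < fst p \<Longrightarrow> b < fst p \<Longrightarrow> (a, b) \<in> (snd p)\<^sup>*"
    using p by (auto simp: patterns_def)
  have mem: "(g a, g b) \<in> plant p W \<longleftrightarrow> (a, b) \<in> snd p" if "a < fst p" "b < fst p" for a b
  proof
    assume "(g a, g b) \<in> plant p W"
    then obtain a' b' where ab: "(a', b') \<in> snd p" "g a = g a'" "g b = g b'" by (auto simp: plant)
    then have "a' < fst p" "b' < fst p" using D(1) by auto
    then have "a = a'" "b = b'" using ab that g by (auto simp: bij_betw_def inj_on_def)
    then show "(a, b) \<in> snd p" using ab by simp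
  qed (force simp: plant)
  have W_eq: "W = g ` {..<fst p}" using g by (simp add: bij_betw_def)
  show sub: "plant p W \<subseteq> W \<times> W"
  proof -
    have "map_prod g g ` snd p \<subseteq> W \<times> W" unfolding W_eq using D(1) by auto
    then show ?thesis by (simp only: plant)
  qed
  show "sym (plant p W)" using D(2) by (auto simp: plant sym_def)
  show "irrefl (plant p W)"
    unfolding irrefl_def
  proof
    fix u
    show "(u, u) \<notin> plant p W"
    proof
      assume u: "(u, u) \<in> plant p W"
      then obtain a where "a < fst p" "u = g a" using sub by (auto simp: W_eq)
      then show False using mem[of a a] u D(3) by (simp add: irrefl_def)
    qed
  qed
  show "(u, w) \<in> (plant p W)\<^sup>*" if uw: "u \<in> W" "w \<in> W" for u w
  proof -
    obtain a b where ab: "a < fst p" "b < fst p" "u = g a" "w = g b" using uw by (auto simp: W_eq)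
    have "(g a, g b) \<in> (plant p W)\<^sup>*" using D(4)[OF ab(1,2)]
    proof induction
      case (step y z)
      then have "(g y, g z) \<in> plant p W" by (force simp: plant)
      with step.IH show ?case by (rule rtrancl_into_rtrancl)
    qed simp
    then show ?thesis using ab by simp
  qed
  show "matches p W (E \<union> plant p W)" if E: "E \<inter> W \<times> W = {}" for E
  proof -
    have "(g a, g b) \<in> E \<union> plant p W \<longleftrightarrow> (a, b) \<in> snd p" if "a < fst p" "b < fst p" for a b
      using mem[OF that] E that by (auto simp: W_eq)
    then have "block_pattern (E \<union> plant p W) (fst p) g = p"
      using D(1) by (cases p) (auto simp: block_pattern_def)
    then show ?thesis unfolding matches_def using g by blast
  qed
qed

text \<open>No arc of \<open>E\<close> touches \<open>W\<close>, so the planted arcs form a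
  component of their own and all other components stay as they are. Hence at most one copy is new,
  and deleting the arcs inside \<open>W\<close> restores \<open>E\<close>.\<close>

lemma plant_in_isolated:
  assumes fin: "finite V" and E: "E \<in> bounded_arcs k V" and p: "p \<in> patterns k"
    and W: "W \<subseteq> isolated V E" "card W = fst p"
  shows "E \<union> plant p W \<in> bounded_arcs k V" "W \<in> copies p V (E \<union> plant p W)"
    and "copies p V (E \<union> plant p W) \<subseteq> insert W (copies p V E)"
    and "(E \<union> plant p W) - W \<times> W = E"
proof -
  let ?F = "E \<union> plant p W"
  have subE: "E \<subseteq> V \<times> V" and symE: "sym E" and irr: "irrefl E"
    and card: "\<And>u. u \<in> V \<Longrightarrow> card (E\<^sup>* `` {u}) \<le> k"
    using E by (auto simp: bounded_arcs_def)
  have WV: "W \<subseteq> V" using W by (auto simp: isolated_def)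
  then have finW: "finite W" using fin by (rule finite_subset)
  note pl = plant_properties[OF p finW W(2)]
  have iso: "(u, w) \<notin> E" "(w, u) \<notin> E" if "u \<in> W" for u w
    using that W(1) symE by (auto simp: isolated_def dest: symD)
  have reach_in: "?F\<^sup>* `` {u} = W" if "u \<in> W" for u
  proof (intro equalityI subsetI)
    fix w assume "w \<in> ?F\<^sup>* `` {u}"
    moreover have "?F `` W \<subseteq> W" using iso pl(1) by auto
    ultimately show "w \<in> W" using that Image_closed_trancl[of ?F W] by blast
  next
    fix w assume "w \<in> W"
    then have "(u, w) \<in> (plant p W)\<^sup>*" using pl(4) that by blast
    then show "w \<in> ?F\<^sup>* `` {u}" using rtrancl_mono[of "plant p W" ?F] by auto
  qed
  have reach_out: "?F\<^sup>* `` {u} = E\<^sup>* `` {u}" and disj: "E\<^sup>* `` {u} \<inter> W = {}" if "u \<notin> W" for u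
  proof -
    have "E `` (- W) \<subseteq> - W" using iso by auto
    then have "E\<^sup>* `` {u} \<subseteq> - W" using that Image_closed_trancl[of E "- W"] by blast
    then show "E\<^sup>* `` {u} \<inter> W = {}" by blast
    \<comment> \<open>A class avoiding \<open>W\<close> meets no planted arc, so it is closed under
      the enlarged relation too.\<close>
    then have "?F `` (E\<^sup>* `` {u}) \<subseteq> E\<^sup>* `` {u}"
      using pl(1) by (auto intro: rtrancl_into_rtrancl)
    then have "?F\<^sup>* `` {u} \<subseteq> E\<^sup>* `` {u}" using Image_closed_trancl[of ?F "E\<^sup>* `` {u}"] by blast
    then show "?F\<^sup>* `` {u} = E\<^sup>* `` {u}" using rtrancl_mono[of E ?F] by blast
  qed
  have "fst p \<le> k" "1 \<le> fst p" using p by (auto simp: patterns_def)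
  then have "card (?F\<^sup>* `` {u}) \<le> k" if "u \<in> V" for u
    using reach_in reach_out card[OF that] W(2) by (cases "u \<in> W") auto
  moreover have "?F \<subseteq> V \<times> V" using subE pl(1) WV by blast
  ultimately show "?F \<in> bounded_arcs k V"
    using symE irr pl(2,3) by (auto simp: bounded_arcs_def irrefl_def intro: sym_Un)
  obtain u where "u \<in> W" using \<open>1 \<le> fst p\<close> W(2) by fastforce
  then have "W \<in> components V ?F"
    unfolding components_def using reach_in WV by (intro image_eqI[of _ _ u]) auto
  moreover have "matches p W ?F" using pl(5)[of E] iso by blast
  ultimately show "W \<in> copies p V ?F" by (simp add: copies_def)
  show "copies p V ?F \<subseteq> insert W (copies p V E)"
  proof
    fix C assume C: "C \<in> copies p V ?F"
    then obtain u where u: "u \<in> V" "C = ?F\<^sup>* `` {u}" by (auto simp: copies_def components_def)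
    show "C \<in> insert W (copies p V E)"
    proof (cases "u \<in> W")
      case True
      then show ?thesis using reach_in u by simp
    next
      case False
      have "C = E\<^sup>* `` {u}" using u reach_out[OF False] by simp
      moreover have "C \<inter> W = {}" using disj[OF False] calculation by simp
      obtain g where g: "bij_betw g {..<fst p} C" "block_pattern ?F (fst p) g = p"
        using C by (auto simp: copies_def matches_def)
      have "g a \<notin> W" if "a < fst p" for a
        using g(1) that \<open>C \<inter> W = {}\<close> by (auto simp: bij_betw_def)
      then have "block_pattern E (fst p) g = block_pattern ?F (fst p) g"
        using pl(1) by (auto simp: block_pattern_def)
      then have "matches p C E" unfolding matches_def using g by auto
      ultimately show ?thesis using u(1) by (auto simp: copies_def components_def)
    qed
  qed
  show "?F - W \<times> W = E" using pl(1) iso by blast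
qed

text \<open>Each graph with \<open>r\<close> isolated vertices offers at least
  \<open>r choose fst p\<close> sets \<open>W\<close>. After planting there are at most m + 1 copies
  and \<open>W\<close> is one of them, so each result arises from at most m + 1 pairs.\<close>

lemma few_copies_bound:
  assumes fin: "finite V" and p: "p \<in> patterns k"
  shows "(r choose fst p) *
      card {E \<in> bounded_arcs k V. r \<le> card (isolated V E) \<and> card (copies p V E) \<le> m}
    \<le> (m + 1) * card (bounded_arcs k V)"
proof -
  let ?A = "{E \<in> bounded_arcs k V. r \<le> card (isolated V E) \<and> card (copies p V E) \<le> m}"
  let ?S = "\<lambda>E. {W. W \<subseteq> isolated V E \<and> card W = fst p}"
  let ?P = "SIGMA E:?A. ?S E"
  let ?B = "{E \<in> bounded_arcs k V. card (copies p V E) \<le> m + 1}"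
  let ?Q = "SIGMA E:?B. copies p V E"
  let ?f = "\<lambda>(E, W). (E \<union> plant p W, W)"
  have finA: "finite ?A" and finB: "finite ?B" using finite_bounded_arcs[OF fin] by auto
  have fin_iso: "finite (isolated V E)" for E using fin by (simp add: isolated_def)
  have fin_copies: "finite (copies p V E)" for E using fin by (simp add: copies_def components_def)
  have "(r choose fst p) * card ?A = (\<Sum>E\<in>?A. r choose fst p)" by simp
  also have "\<dots> \<le> (\<Sum>E\<in>?A. card (?S E))"
    by (intro sum_mono) (simp add: n_subsets[OF fin_iso] binomial_right_mono)
  also have "\<dots> = card ?P"
    using finA fin_iso by (subst card_SigmaI) auto
  also have "\<dots> \<le> card ?Q"
  proof (rule card_inj_on_le[of ?f])
    have E: "E = (E \<union> plant p W) - W \<times> W" if "(E, W) \<in> ?P" for E W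
      using plant_in_isolated(4)[OF fin _ p, of E W] that by auto
    show "inj_on ?f ?P"
    proof (rule inj_onI)
      fix x y assume x: "x \<in> ?P" and y: "y \<in> ?P" and eq: "?f x = ?f y"
      then have "snd x = snd y" "fst x \<union> plant p (snd x) = fst y \<union> plant p (snd y)"
        by (auto simp: split_beta)
      then show "x = y" using E[of "fst x" "snd x"] E[of "fst y" "snd y"] x y
        by (metis prod.collapse)
    qed
    show "finite ?Q" using finB fin_copies by (intro finite_SigmaI) auto
    have "?f (E, W) \<in> ?Q" if E: "E \<in> ?A" and W: "W \<in> ?S E" for E W
    proof -
      have E': "E \<in> bounded_arcs k V" and W': "W \<subseteq> isolated V E" "card W = fst p"
        using E W by auto
      note pl = plant_in_isolated[OF fin E' p W']
      have "card (copies p V (E \<union> plant p W)) \<le> card (insert W (copies p V E))"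
        using pl(3) fin_copies by (intro card_mono) auto
      also have "\<dots> \<le> m + 1"
        using E card_insert_le_m1[of "m + 1" "copies p V E" W] by simp
      finally show ?thesis using pl(1,2) by simp
    qed
    then show "?f ` ?P \<subseteq> ?Q" by auto
  qed
  also have "card ?Q = (\<Sum>E\<in>?B. card (copies p V E))"
    using finB fin_copies by (subst card_SigmaI) auto
  also have "\<dots> \<le> (\<Sum>E\<in>?B. m + 1)" by (intro sum_mono) auto
  also have "\<dots> \<le> (m + 1) * card (bounded_arcs k V)"
    using card_mono[OF finite_bounded_arcs[OF fin], of ?B k]
    by (simp only: sum_constant of_nat_id mult.commute[of "card ?B"]) (intro mult_left_mono, auto)
  finally show ?thesis .
qed

section \<open>Passing to the limit\<close>

abbreviation arcs_prob :: "nat \<Rightarrow> nat \<Rightarrow> (nat rel \<Rightarrow> bool) \<Rightarrow> real" where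
  "arcs_prob k n P \<equiv> measure_pmf.prob (pmf_of_set (bounded_arcs k {1..n})) {E. P E}"

lemma arcs_prob_eq:
  assumes "k \<ge> 1"
  shows "arcs_prob k n P =
    card {E \<in> bounded_arcs k {1..n}. P E} / card (bounded_arcs k {1..n})"
  using empty_in_bounded_arcs[OF assms] finite_bounded_arcs[of "{1..n}" k]
  by (subst measure_pmf_of_set) (auto simp: Int_def)

lemma arcs_prob_le:
  assumes "k \<ge> 1" "0 < c"
    and "c * card {E \<in> bounded_arcs k {1..n}. P E} \<le> d * card (bounded_arcs k {1..n})"
  shows "arcs_prob k n P \<le> real d / real c"
proof -
  have "0 < card (bounded_arcs k {1..n})"
    using empty_in_bounded_arcs[OF assms(1)] finite_bounded_arcs[of "{1..n}" k]
    by (auto simp: card_gt_0_iff)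
  moreover have "real c * card {E \<in> bounded_arcs k {1..n}. P E} \<le> real d * card (bounded_arcs k {1..n})"
    using assms(3) by (simp only: of_nat_mult[symmetric] of_nat_le_iff)
  ultimately show ?thesis
    using assms(2) unfolding arcs_prob_eq[OF assms(1)] by (simp add: divide_simps mult.commute)
qed

lemma few_isolated_tendsto:
  assumes "k \<ge> 1"
  shows "(\<lambda>n. arcs_prob k n (\<lambda>E. card (isolated {1..n} E) \<le> m)) \<longlonglongrightarrow> 0"
proof (rule tendsto_sandwich)
  let ?K = "k * 2 ^ ((m + k) + (m + k) * (m + k))"
  show "\<forall>\<^sub>F n in sequentially. 0 \<le> arcs_prob k n (\<lambda>E. card (isolated {1..n} E) \<le> m)" by simp
  show "\<forall>\<^sub>F n in sequentially. arcs_prob k n (\<lambda>E. card (isolated {1..n} E) \<le> m) \<le> real ?K / real n"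
    using eventually_gt_at_top[of 0]
  proof eventually_elim
    case (elim n)
    show ?case
      using few_isolated_bound[of "{1..n}" k m] elim by (intro arcs_prob_le[OF assms]) simp_all
  qed
  show "(\<lambda>n. real ?K / real n) \<longlonglongrightarrow> 0" by (rule lim_const_over_n)
qed simp

lemma few_copies_tendsto:
  assumes k: "k \<ge> 1" and p: "p \<in> patterns k"
  shows "(\<lambda>n. arcs_prob k n (\<lambda>E. card (copies p {1..n} E) \<le> m)) \<longlonglongrightarrow> 0"
proof (rule LIMSEQ_I)
  fix \<epsilon> :: real assume "\<epsilon> > 0"
  have h: "1 \<le> fst p" using p by (auto simp: patterns_def)
  \<comment> \<open>With r = h * s, where h is \<open>fst p\<close>, the binomial coefficient is at
    least (r / h)^h = s^h \<ge> s, so this \<open>s\<close> pushes (m + 1) / (r choose h) below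
    \<epsilon> / 2.\<close>
  obtain s where s: "real (m + 1) / (\<epsilon> / 2) < real s" using reals_Archimedean2 by blast
  have "0 < real (m + 1) / (\<epsilon> / 2)" using \<open>\<epsilon> > 0\<close> by (intro divide_pos_pos) auto
  also note s
  finally have "0 < real s" .
  define r where "r = fst p * s"
  have "real s ^ 1 \<le> real s ^ fst p" using h \<open>0 < real s\<close> by (intro power_increasing) auto
  also have "\<dots> = (real r / real (fst p)) ^ fst p" using h by (simp add: r_def)
  also have "\<dots> \<le> real (r choose fst p)"
    using \<open>0 < real s\<close> by (intro binomial_ge_n_over_k_pow_k) (simp add: r_def)
  finally have rs: "real s \<le> real (r choose fst p)" by simp
  have "real (m + 1) < \<epsilon> / 2 * real s" using s \<open>\<epsilon> > 0\<close> by (simp add: field_simps)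
  also have "\<dots> \<le> \<epsilon> / 2 * real (r choose fst p)" using rs \<open>\<epsilon> > 0\<close> by (intro mult_left_mono) auto
  finally have small: "real (m + 1) / real (r choose fst p) < \<epsilon> / 2"
    by (simp only: pos_divide_less_eq[OF order.strict_trans2[OF \<open>0 < real s\<close> rs]])
  obtain N where N: "\<And>n. n \<ge> N \<Longrightarrow> norm (arcs_prob k n (\<lambda>E. card (isolated {1..n} E) \<le> r) - 0) < \<epsilon> / 2"
    using LIMSEQ_D[OF few_isolated_tendsto[OF k, of r]] \<open>\<epsilon> > 0\<close> by (metis half_gt_zero)
  have "norm (arcs_prob k n (\<lambda>E. card (copies p {1..n} E) \<le> m) - 0) < \<epsilon>" if n: "n \<ge> N" for n
  proof -
    let ?iso = "\<lambda>E. card (isolated {1..n} E)" and ?cop = "\<lambda>E. card (copies p {1..n} E)"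
    \<comment> \<open>Few copies are split by the number of isolated vertices. The two events
      overlap where that number is \<open>r\<close>, which only weakens the bound.\<close>
    have "arcs_prob k n (\<lambda>E. ?cop E \<le> m) \<le>
        measure_pmf.prob (pmf_of_set (bounded_arcs k {1..n})) ({E. ?iso E \<le> r} \<union> {E. r \<le> ?iso E \<and> ?cop E \<le> m})"
      by (intro measure_pmf.finite_measure_mono) auto
    also have "\<dots> \<le> arcs_prob k n (\<lambda>E. ?iso E \<le> r) + arcs_prob k n (\<lambda>E. r \<le> ?iso E \<and> ?cop E \<le> m)"
      by (rule measure_Un_le) auto
    also have "arcs_prob k n (\<lambda>E. r \<le> ?iso E \<and> ?cop E \<le> m) \<le> real (m + 1) / real (r choose fst p)"
    proof (rule arcs_prob_le[OF k])
      show "0 < (r choose fst p)"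
        using order.strict_trans2[OF \<open>0 < real s\<close> rs] by (simp only: of_nat_0_less_iff)
    qed (rule few_copies_bound[OF finite_atLeastAtMost p])
    also have "arcs_prob k n (\<lambda>E. ?iso E \<le> r) + real (m + 1) / real (r choose fst p) < \<epsilon> / 2 + \<epsilon> / 2"
    proof (rule add_strict_mono)
      show "arcs_prob k n (\<lambda>E. ?iso E \<le> r) < \<epsilon> / 2" using N[OF n] by simp
    qed (rule small)
    finally show ?thesis by simp
  qed
  then show "\<exists>N. \<forall>n\<ge>N. norm (arcs_prob k n (\<lambda>E. card (copies p {1..n} E) \<le> m) - 0) < \<epsilon>" by blast
qed

text \<open>A union bound over the finitely many canonical patterns. Membership in
  \<open>bounded_arcs\<close> is part of the event because the comparison of two graphs relies on
  it.\<close>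

lemma many_copies_tendsto:
  assumes k: "k \<ge> 1"
  shows "(\<lambda>n. arcs_prob k n (\<lambda>E. E \<in> bounded_arcs k {1..n} \<and>
    (\<forall>p\<in>canonical_patterns k. m \<le> card (copies p {1..n} E)))) \<longlonglongrightarrow> 1"
proof -
  let ?many = "\<lambda>n E. E \<in> bounded_arcs k {1..n} \<and>
    (\<forall>p\<in>canonical_patterns k. m \<le> card (copies p {1..n} E))"
  let ?few = "\<lambda>n p. arcs_prob k n (\<lambda>E. card (copies p {1..n} E) \<le> m)"
  have fin: "finite (canonical_patterns k)"
    using finite_patterns by (rule finite_subset[rotated]) (auto simp: canonical_patterns_def)
  have "(\<lambda>n. \<Sum>p\<in>canonical_patterns k. ?few n p) \<longlonglongrightarrow> (\<Sum>p\<in>canonical_patterns k. 0)"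
    by (intro tendsto_sum few_copies_tendsto[OF k]) (auto simp: canonical_patterns_def)
  then have "(\<lambda>n. \<Sum>p\<in>canonical_patterns k. ?few n p) \<longlonglongrightarrow> 0" by simp
  from tendsto_diff[OF tendsto_const[of "1::real"] this]
  have lim: "(\<lambda>n. 1 - (\<Sum>p\<in>canonical_patterns k. ?few n p)) \<longlonglongrightarrow> 1"
    by simp
  have "1 - (\<Sum>p\<in>canonical_patterns k. ?few n p) \<le> arcs_prob k n (?many n)" for n
  proof -
    let ?M = "pmf_of_set (bounded_arcs k {1..n})"
    have supp: "set_pmf ?M = bounded_arcs k {1..n}"
      using empty_in_bounded_arcs[OF k] finite_bounded_arcs by (intro set_pmf_of_set) auto
    have "1 - arcs_prob k n (?many n) = measure_pmf.prob ?M (- {E. ?many n E})"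
      using measure_pmf.prob_compl[of "{E. ?many n E}" ?M] by (simp add: Compl_eq_Diff_UNIV)
    \<comment> \<open>The complement also contains relations outside the class; restricting to the
      support leaves only failures caused by a rare pattern.\<close>
    also have "\<dots> = measure_pmf.prob ?M (- {E. ?many n E} \<inter> set_pmf ?M)"
      by (simp add: measure_Int_set_pmf)
    also have "\<dots> \<le> measure_pmf.prob ?M (\<Union>p\<in>canonical_patterns k. {E. card (copies p {1..n} E) \<le> m})"
      unfolding supp by (intro measure_pmf.finite_measure_mono) auto
    also have "\<dots> \<le> (\<Sum>p\<in>canonical_patterns k. ?few n p)"
      using fin by (intro measure_pmf.finite_measure_subadditive_finite) auto
    finally show ?thesis by simp
  qed
  then show ?thesis
    by (intro tendsto_sandwich[OF _ _ lim tendsto_const]) auto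
qed

text \<open>If one nonempty graph with many copies satisfies the sentence, all graphs with many
  copies do, and the probability is bounded below by a sequence tending to 1. Otherwise, for n \<ge>
  1, it is bounded above by the probability of the complement.\<close>

theorem theorem1p9:
  fixes k :: nat and \<phi> :: mso
  assumes "k \<ge> 1" and "mso_sentence \<phi>"
  shows "\<exists>l\<in>{0, 1::real}.
    (\<lambda>n. measure_pmf.prob (random_graph k n) {G. mso_models G \<phi>}) \<longlonglongrightarrow> l"
proof -
  let ?G = "\<lambda>(n::nat) E. \<lparr>pverts = {1..n}, parcs = E\<rparr>"
  let ?many = "\<lambda>(n::nat) E. E \<in> bounded_arcs k {1..n} \<and>
    (\<forall>p\<in>canonical_patterns k. 2 ^ k * threshold k \<phi> \<le> card (copies p {1..n} E))"
  let ?sat = "\<lambda>n. arcs_prob k n (\<lambda>E. mso_models (?G n E) \<phi>)"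
  have agree: "mso_models (?G n E) \<phi> \<longleftrightarrow> mso_models (?G n' E') \<phi>"
    if "n \<ge> 1" "?many n E" "?many n' E'" for n n' E E'
    using that
    \<comment> \<open>\<open>0\<close> lies outside every \<open>{1..n}\<close> and serves as the
      value that leaves no trace.\<close>
    by (intro mso_models_eq_if_many_copies[OF assms(2), where w = 0 and w' = 0]) auto
  note many = many_copies_tendsto[OF assms(1), of "2 ^ k * threshold k \<phi>"]
  show ?thesis
  proof (cases "\<exists>n E. n \<ge> 1 \<and> ?many n E \<and> mso_models (?G n E) \<phi>")
    case True
    then have "mso_models (?G n E) \<phi>" if "?many n E" for n E
      using agree that by blast
    then have "arcs_prob k n (?many n) \<le> ?sat n" for n
      by (intro measure_pmf.finite_measure_mono) auto
    then have "?sat \<longlonglongrightarrow> 1"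
      by (intro tendsto_sandwich[OF _ _ many tendsto_const]) auto
    then show ?thesis by (simp add: prob_random_graph[OF assms(1)])
  next
    case False
    have "?sat n \<le> 1 - arcs_prob k n (?many n)" if "n \<ge> 1" for n
    proof -
      let ?M = "pmf_of_set (bounded_arcs k {1..n})"
      have "?sat n \<le> measure_pmf.prob ?M (- {E. ?many n E})"
        using False that by (intro measure_pmf.finite_measure_mono) auto
      also have "\<dots> = 1 - arcs_prob k n (?many n)"
        using measure_pmf.prob_compl[of "{E. ?many n E}" ?M] by (simp add: Compl_eq_Diff_UNIV)
      finally show ?thesis .
    qed
    then have le: "\<forall>\<^sub>F n in sequentially. ?sat n \<le> 1 - arcs_prob k n (?many n)"
      by (intro eventually_sequentiallyI[of 1])
    have "(\<lambda>n. 1 - arcs_prob k n (?many n)) \<longlonglongrightarrow> 0"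
      using tendsto_diff[OF tendsto_const[of "1::real"] many] by simp
    then have "?sat \<longlonglongrightarrow> 0"
      by (intro tendsto_sandwich[OF _ le tendsto_const]) auto
    then show ?thesis by (simp add: prob_random_graph[OF assms(1)])
  qed
qed

end
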